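(* Let $n\geq2$ and let $M$ be a monoid. Define the alphabet $X_n=\{e_{ij;\mathbf a}: i,j\in\{1,\ldots,n\},\ i\neq j,\ \mathbf a\in M^n\}$, write $e_{ij}=e_{ij;(1,\ldots,1)}$, and let $\phi_n:X_n^+\to M\wr\mathrm{Sing}_n$ be the homomorphism with $e_{ij;\mathbf a}\phi_n=\varepsilon_{ij;\mathbf a}$. Let $R_n$ be the following set of relations over $X_n$: - $e_{ij;\mathbf a}e_{ij}=e_{ij;\mathbf a}=e_{ji;\mathbf a}e_{ij}$, for $\mathbf a\in M^n$ and distinct $i,j$; - $e_{ij;\mathbf a}e_{kl}=e_{kl;\mathbf a}e_{ij}$, for $\mathbf a\in M^n$ and distinct $i,j,k,l$; - $e_{ik;\mathbf a}e_{jk}=e_{ik;\mathbf a}$, for $\mathbf a\in M^n$ and distinct $i,j,k$; - $e_{ij;\mathbf a}e_{ik}=e_{ik;\mathbf a}e_{ij}=e_{jk;\mathbf a}e_{ij}$, for $\mathbf a\in M^n$ and distinct $i,j,k$; - $e_{ki;\mathbf a}e_{ij}e_{jk}=e_{ik;\mathbf a}e_{kj}e_{ji}e_{ik}$, for $\mathbf a\in M^n$ and distinct $i,j,k$; - $e_{ki;\mathbf a}e_{ij}e_{jk}e_{kl}=e_{ik;\mathbf a}e_{kl}e_{li}e_{ij}e_{jl}$, for $\mathbf a\in M^n$ and distinct $i,j,k,l$; - $e_{ij;\mathbf a}e_{kl;\mathbf b}=e_{ij;\mathbf c}e_{kl}$, for $\mathbf a,\mathbf b\in M^n$ and any $i,j,k,l$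 with $i\neq j$ and $k\neq l$ (not otherwise assumed distinct), where $\mathbf c=(c_1,\ldots,c_n)$ is given by $c_j=a_jb_i$ and $c_r=a_rb_r$ for $r\neq j$. Then the semigroup $M\wr\mathrm{Sing}_n$ has semigroup presentation $\langle X_n:R_n\rangle$ via $\phi_n$.
   Context: Maps are written on the right and composed from left to right. $\mathcal T_n$ is the monoid of all maps $\{1,\ldots,n\}\to\{1,\ldots,n\}$, and $\mathrm{Sing}_n$ is its subsemigroup of all non-bijective maps. The wreath product $M\wr\mathrm{Sing}_n$ is the set $M^n\times\mathrm{Sing}_n$ with product $$((a_1,\ldots,a_n),\alpha)((b_1,\ldots,b_n),\beta)=((a_1b_{1\alpha},\ldots,a_nb_{n\alpha}),\alpha\beta).$$ For distinct $i,j\in\{1,\ldots,n\}$, $\varepsilon_{ij}\in\mathrm{Sing}_n$ is the map with $j\varepsilon_{ij}=i$ and $k\varepsilon_{ij}=k$ for $k\neq j$; for $\mathbf a\in M^n$, $\varepsilon_{ij;\mathbf a}=(\mathbf a,\varepsilon_{ij})\in M\wr\mathrm{Sing}_n$. For an alphabet $X$, $X^+$ is the free semigroup on $X$. A relation $u=v$ stands for the pair $(u,v)\in X^+\times X^+$ (a chain $u=v=w$ stands for $u=v$ and $v=w$), and $R^\sharp$ is the congruence on $X^+$ generated by a set $R$ of relations. A semigroup $T$ has semigroup presentation $\langle X:R\rangle$ via $\phi:X^+\to T$ if $\phi$ is a surjective homomorphism with kernel $\{(u,v):u\phi=v\phi\}=R^\sharp$. *)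

theory Defs
  imports "HOL-Algebra.Group" "HOL-Library.FuncSet"
begin

section \<open>Semigroups, congruences and semigroup presentations\<close>

record 'a semigrp = "'a partial_object" +
  smult :: "'a \<Rightarrow> 'a \<Rightarrow> 'a"  (infixl \<open>\<odot>\<index>\<close> 70)

locale semigrp =
  fixes S (structure)
  assumes smult_closed: "\<lbrakk>x \<in> carrier S; y \<in> carrier S\<rbrakk> \<Longrightarrow> x \<odot> y \<in> carrier S"
    and smult_assoc: "\<lbrakk>x \<in> carrier S; y \<in> carrier S; z \<in> carrier S\<rbrakk>
          \<Longrightarrow> (x \<odot> y) \<odot> z = x \<odot> (y \<odot> z)"

definition semigrp_hom ::
    "('a, 'c) semigrp_scheme \<Rightarrow> ('b, 'd) semigrp_scheme \<Rightarrow> ('a \<Rightarrow> 'b) set" where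
  "semigrp_hom S T = {h \<in> carrier S \<rightarrow> carrier T.
     \<forall>x \<in> carrier S. \<forall>y \<in> carrier S. h (x \<odot>\<^bsub>S\<^esub> y) = h x \<odot>\<^bsub>T\<^esub> h y}"

definition semigrp_congruence :: "('a, 'c) semigrp_scheme \<Rightarrow> ('a \<times> 'a) set \<Rightarrow> bool" where
  "semigrp_congruence S \<rho> \<longleftrightarrow> equiv (carrier S) \<rho> \<and>
     (\<forall>(x, y) \<in> \<rho>. \<forall>z \<in> carrier S.
        (z \<odot>\<^bsub>S\<^esub> x, z \<odot>\<^bsub>S\<^esub> y) \<in> \<rho> \<and> (x \<odot>\<^bsub>S\<^esub> z, y \<odot>\<^bsub>S\<^esub> z) \<in> \<rho>)"

text \<open>Meaningful only for relations on the carrier; otherwise the intersection is over the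
  empty family.\<close>
definition generated_congruence ::
    "('a, 'c) semigrp_scheme \<Rightarrow> ('a \<times> 'a) set \<Rightarrow> ('a \<times> 'a) set" where
  "generated_congruence S R = \<Inter>{\<rho>. semigrp_congruence S \<rho> \<and> R \<subseteq> \<rho>}"

definition free_semigrp :: "'x set \<Rightarrow> 'x list semigrp" where
  "free_semigrp X = \<lparr>carrier = {w. w \<noteq> [] \<and> set w \<subseteq> X}, smult = (@)\<rparr>"

text \<open>The homomorphism from the free semigroup extending a map \<open>f\<close> on the letters; the value on
  the empty word, which is not in the free semigroup, is irrelevant.\<close>
fun free_ext :: "('b, 'd) semigrp_scheme \<Rightarrow> ('x \<Rightarrow> 'b) \<Rightarrow> 'x list \<Rightarrow> 'b" where
  "free_ext T f [] = undefined"
| "free_ext T f [x] = f x"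
| "free_ext T f (x # y # w) = f x \<odot>\<^bsub>T\<^esub> free_ext T f (y # w)"

definition has_semigrp_presentation ::
    "('b, 'd) semigrp_scheme \<Rightarrow> 'x set \<Rightarrow> ('x list \<times> 'x list) set \<Rightarrow> ('x list \<Rightarrow> 'b) \<Rightarrow> bool" where
  "has_semigrp_presentation T X R \<phi> \<longleftrightarrow>
     semigrp T \<and>
     R \<subseteq> carrier (free_semigrp X) \<times> carrier (free_semigrp X) \<and>
     \<phi> \<in> semigrp_hom (free_semigrp X) T \<and>
     \<phi> ` carrier (free_semigrp X) = carrier T \<and>
     {(u, v). u \<in> carrier (free_semigrp X) \<and> v \<in> carrier (free_semigrp X) \<and> \<phi> u = \<phi> v}
       = generated_congruence (free_semigrp X) R"

section \<open>Singular transformations and the wreath product\<close>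

text \<open>Maps are written on the right in the source: \<open>k\<alpha>\<close> is \<open>\<alpha> k\<close>, and the product \<open>\<alpha>\<beta>\<close>
  (first \<open>\<alpha>\<close>, then \<open>\<beta>\<close>) is \<open>compose {1..n} \<beta> \<alpha>\<close>.  Maps and tuples on \<open>{1..n}\<close> are
  extensional functions.\<close>

definition sing :: "nat \<Rightarrow> (nat \<Rightarrow> nat) set" where
  "sing n = {\<alpha> \<in> {1..n} \<rightarrow>\<^sub>E {1..n}. \<not> bij_betw \<alpha> {1..n} {1..n}}"

definition tuples :: "('a, 'c) monoid_scheme \<Rightarrow> nat \<Rightarrow> (nat \<Rightarrow> 'a) set" where
  "tuples M n = {1..n} \<rightarrow>\<^sub>E carrier M"

definition one_tuple :: "('a, 'c) monoid_scheme \<Rightarrow> nat \<Rightarrow> nat \<Rightarrow> 'a" where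
  "one_tuple M n = (\<lambda>k \<in> {1..n}. \<one>\<^bsub>M\<^esub>)"

definition wreath_sing ::
    "('a, 'c) monoid_scheme \<Rightarrow> nat \<Rightarrow> ((nat \<Rightarrow> 'a) \<times> (nat \<Rightarrow> nat)) semigrp" where
  "wreath_sing M n =
     \<lparr>carrier = tuples M n \<times> sing n,
      smult = (\<lambda>(a, \<alpha>) (b, \<beta>).
        (\<lambda>k \<in> {1..n}. a k \<otimes>\<^bsub>M\<^esub> b (\<alpha> k), compose {1..n} \<beta> \<alpha>))\<rparr>"

definition eps :: "nat \<Rightarrow> nat \<Rightarrow> nat \<Rightarrow> nat \<Rightarrow> nat" where
  "eps n i j = (\<lambda>k \<in> {1..n}. if k = j then i else k)"

section \<open>The alphabet, the relations and the map\<close>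

datatype 'a letter = E nat nat "nat \<Rightarrow> 'a"

definition alphabet :: "('a, 'c) monoid_scheme \<Rightarrow> nat \<Rightarrow> 'a letter set" where
  "alphabet M n = {E i j a | i j a. i \<in> {1..n} \<and> j \<in> {1..n} \<and> i \<noteq> j \<and> a \<in> tuples M n}"

abbreviation E1 :: "('a, 'c) monoid_scheme \<Rightarrow> nat \<Rightarrow> nat \<Rightarrow> nat \<Rightarrow> 'a letter" where
  "E1 M n i j \<equiv> E i j (one_tuple M n)"

fun letter_val :: "nat \<Rightarrow> 'a letter \<Rightarrow> (nat \<Rightarrow> 'a) \<times> (nat \<Rightarrow> nat)" where
  "letter_val n (E i j a) = (a, eps n i j)"

definition phi ::
    "('a, 'c) monoid_scheme \<Rightarrow> nat \<Rightarrow> 'a letter list \<Rightarrow> (nat \<Rightarrow> 'a) \<times> (nat \<Rightarrow> nat)" where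
  "phi M n = free_ext (wreath_sing M n) (letter_val n)"

text \<open>A chain \<open>u = v = w\<close> is split into the pairs \<open>(u, v)\<close> and \<open>(v, w)\<close>.\<close>
inductive_set rels ::
    "('a, 'c) monoid_scheme \<Rightarrow> nat \<Rightarrow> ('a letter list \<times> 'a letter list) set"
  for M :: "('a, 'c) monoid_scheme" and n :: nat where
  R1a: "\<lbrakk>a \<in> tuples M n; {i, j} \<subseteq> {1..n}; distinct [i, j]\<rbrakk> \<Longrightarrow>
    ([E i j a, E1 M n i j], [E i j a]) \<in> rels M n"
| R1b: "\<lbrakk>a \<in> tuples M n; {i, j} \<subseteq> {1..n}; distinct [i, j]\<rbrakk> \<Longrightarrow>
    ([E i j a], [E j i a, E1 M n i j]) \<in> rels M n"
| R2: "\<lbrakk>a \<in> tuples M n; {i, j, k, l} \<subseteq> {1..n}; distinct [i, j, k, l]\<rbrakk> \<Longrightarrow>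
    ([E i j a, E1 M n k l], [E k l a, E1 M n i j]) \<in> rels M n"
| R3: "\<lbrakk>a \<in> tuples M n; {i, j, k} \<subseteq> {1..n}; distinct [i, j, k]\<rbrakk> \<Longrightarrow>
    ([E i k a, E1 M n j k], [E i k a]) \<in> rels M n"
| R4a: "\<lbrakk>a \<in> tuples M n; {i, j, k} \<subseteq> {1..n}; distinct [i, j, k]\<rbrakk> \<Longrightarrow>
    ([E i j a, E1 M n i k], [E i k a, E1 M n i j]) \<in> rels M n"
| R4b: "\<lbrakk>a \<in> tuples M n; {i, j, k} \<subseteq> {1..n}; distinct [i, j, k]\<rbrakk> \<Longrightarrow>
    ([E i k a, E1 M n i j], [E j k a, E1 M n i j]) \<in> rels M n"
| R5: "\<lbrakk>a \<in> tuples M n; {i, j, k} \<subseteq> {1..n}; distinct [i, j, k]\<rbrakk> \<Longrightarrow>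
    ([E k i a, E1 M n i j, E1 M n j k],
     [E i k a, E1 M n k j, E1 M n j i, E1 M n i k]) \<in> rels M n"
| R6: "\<lbrakk>a \<in> tuples M n; {i, j, k, l} \<subseteq> {1..n}; distinct [i, j, k, l]\<rbrakk> \<Longrightarrow>
    ([E k i a, E1 M n i j, E1 M n j k, E1 M n k l],
     [E i k a, E1 M n k l, E1 M n l i, E1 M n i j, E1 M n j l]) \<in> rels M n"
| R7: "\<lbrakk>a \<in> tuples M n; b \<in> tuples M n; {i, j, k, l} \<subseteq> {1..n}; i \<noteq> j; k \<noteq> l\<rbrakk> \<Longrightarrow>
    ([E i j a, E k l b],
     [E i j (\<lambda>r \<in> {1..n}. if r = j then a j \<otimes>\<^bsub>M\<^esub> b i else a r \<otimes>\<^bsub>M\<^esub> b r), E1 M n k l])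
      \<in> rels M n"

end

theory Submission
  imports Defs
begin

text \<open>Read the letter \<open>e\<^sub>i\<^sub>j\<close> as moving whatever sits at position \<open>j\<close> to position \<open>i\<close>: a slide if
  \<open>i\<close> is a hole, a merge if \<open>i\<close> is occupied, and idle if \<open>j\<close> is a hole. In these terms every
  word over the undecorated letters can be rewritten so that all merges come first, and these
  can be chosen to depend only on the kernel of the map (each point is merged into the
  least point of its class). It remains to see that two sequences of slides from the same
  position to the same position are congruent, that is, that closed slide sequences are trivial.
  This is an induction on the set of positions in use: fixing a token at \<open>p\<close>, every slide sequence
  is congruent to one that avoids \<open>p\<close>, followed by one of three short detours through \<open>p\<close>; for a
  closed sequence the detour is empty. Relations R5 and R6 are exactly the two nontrivial
  cases of this reduction. Finally R7 concentrates all tuples in the first letter of a word,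
  so the tuple is an invariant and the problem reduces to undecorated words.\<close>

section \<open>Words as sequences of moves\<close>

text \<open>Defined on all of \<open>nat\<close> and read from left to right, so that concatenation
  is composition of right-written maps with no domain to carry along; the restriction to
  \<open>{1..n}\<close> only enters with \<open>phi\<close>.\<close>

definition act :: "(nat \<times> nat) list \<Rightarrow> nat \<Rightarrow> nat" where
  "act w x = fold (\<lambda>(i, j) y. if y = j then i else y) w x"

lemma act_Nil [simp]: "act [] x = x"
  and act_Cons [simp]: "act ((i, j) # w) x = act w (if x = j then i else x)"
  and act_append [simp]: "act (u @ v) x = act v (act u x)"
  by (simp_all add: act_def)

definition letters :: "nat set \<Rightarrow> (nat \<times> nat) set" where
  "letters P = {(i, j). i \<in> P \<and> j \<in> P \<and> i \<noteq> j}"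

lemma in_letters [simp]: "(i, j) \<in> letters P \<longleftrightarrow> i \<in> P \<and> j \<in> P \<and> i \<noteq> j"
  by (simp add: letters_def)

lemma act_in: "w \<in> lists (letters P) \<Longrightarrow> x \<in> P \<Longrightarrow> act w x \<in> P"
  by (induction w arbitrary: x) auto

lemma act_outside: "w \<in> lists (letters P) \<Longrightarrow> x \<notin> P \<Longrightarrow> act w x = x"
  by (induction w arbitrary: x) (auto split: if_splits)

locale positions =
  fixes I :: "nat set"
  assumes finite_I: "finite I"
begin

text \<open>The relations R1 to R6 with the tuples deleted. R7 has no counterpart: without tuples
  its two sides coincide.\<close>

inductive srel :: "(nat \<times> nat) list \<Rightarrow> (nat \<times> nat) list \<Rightarrow> bool" where
  s1a: "{i, j} \<subseteq> I \<Longrightarrow> distinct [i, j] \<Longrightarrow> srel [(i, j), (i, j)] [(i, j)]"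
| s1b: "{i, j} \<subseteq> I \<Longrightarrow> distinct [i, j] \<Longrightarrow> srel [(i, j)] [(j, i), (i, j)]"
| s2: "{i, j, k, l} \<subseteq> I \<Longrightarrow> distinct [i, j, k, l] \<Longrightarrow> srel [(i, j), (k, l)] [(k, l), (i, j)]"
| s3: "{i, j, k} \<subseteq> I \<Longrightarrow> distinct [i, j, k] \<Longrightarrow> srel [(i, k), (j, k)] [(i, k)]"
| s4a: "{i, j, k} \<subseteq> I \<Longrightarrow> distinct [i, j, k] \<Longrightarrow> srel [(i, j), (i, k)] [(i, k), (i, j)]"
| s4b: "{i, j, k} \<subseteq> I \<Longrightarrow> distinct [i, j, k] \<Longrightarrow> srel [(i, k), (i, j)] [(j, k), (i, j)]"
| s5: "{i, j, k} \<subseteq> I \<Longrightarrow> distinct [i, j, k] \<Longrightarrow>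
    srel [(k, i), (i, j), (j, k)] [(i, k), (k, j), (j, i), (i, k)]"
| s6: "{i, j, k, l} \<subseteq> I \<Longrightarrow> distinct [i, j, k, l] \<Longrightarrow>
    srel [(k, i), (i, j), (j, k), (k, l)] [(i, k), (k, l), (l, i), (i, j), (j, l)]"

text \<open>The congruence lives on the free monoid, so that contexts \<open>p\<close> and
  \<open>q\<close> may be empty. No relation has an empty side, hence the empty word is congruent
  only to itself.\<close>

inductive weq :: "(nat \<times> nat) list \<Rightarrow> (nat \<times> nat) list \<Rightarrow> bool"  (infix \<open>\<approx>\<close> 50) where
  weq_refl [simp, intro!]: "u \<approx> u"
| weq_sym: "u \<approx> v \<Longrightarrow> v \<approx> u"
| weq_trans [trans]: "u \<approx> v \<Longrightarrow> v \<approx> w \<Longrightarrow> u \<approx> w"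
| weq_step: "srel u v \<Longrightarrow> p @ u @ q \<approx> p @ v @ q"

lemma weq_append:
  assumes "u \<approx> v"
  shows "p @ u @ q \<approx> p @ v @ q"
  using assms
proof induction
  case (weq_step u v p' q')
  then show ?case
    using weq.weq_step[of u v "p @ p'" "q' @ q"] by simp
qed (auto intro: weq_sym weq_trans)

lemma weq_prefix: "u \<approx> v \<Longrightarrow> p @ u \<approx> p @ v"
  using weq_append[of u v p "[]"] by simp

lemma weq_suffix: "u \<approx> v \<Longrightarrow> u @ q \<approx> v @ q"
  using weq_append[of u v "[]" q] by simp

lemma srel_weq: "srel u v \<Longrightarrow> u \<approx> v"
  using weq_step[of u v "[]" "[]"] by simp

lemma srel_act: "srel u v \<Longrightarrow> act u = act v"
  by (induction rule: srel.induct) (simp_all add: fun_eq_iff)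

lemma weq_act: "u \<approx> v \<Longrightarrow> act u = act v"
  by (induction rule: weq.induct) (auto simp: fun_eq_iff dest: srel_act)

lemma srel_letters:
  "srel u v \<Longrightarrow> u \<noteq> [] \<and> v \<noteq> [] \<and> u \<in> lists (letters I) \<and> v \<in> lists (letters I)"
  by (induction rule: srel.induct) auto

text \<open>The positions still occupied after \<open>w\<close>, if every position of
  \<open>I\<close> holds a token at the start. The rest of \<open>I\<close> are the holes.\<close>

definition img :: "(nat \<times> nat) list \<Rightarrow> nat set" where
  "img w = act w ` I"

lemma img_Nil [simp]: "img [] = I"
  by (simp add: img_def)

lemma img_append: "img (u @ v) = act v ` img u"
  by (auto simp: img_def)

lemma img_snoc:
  "i \<noteq> j \<Longrightarrow> img (w @ [(i, j)]) = (if j \<in> img w then insert i (img w - {j}) else img w)"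
  by (auto simp: img_append image_iff)

lemma weq_img: "u \<approx> v \<Longrightarrow> img u = img v"
  by (simp add: img_def weq_act)

lemma img_subset: "w \<in> lists (letters I) \<Longrightarrow> img w \<subseteq> I"
  unfolding img_def using act_in[of w I] by blast

lemma finite_img [simp]: "finite (img w)"
  by (simp add: img_def finite_I)

section \<open>Idle letters, cancellation and cycles through a hole\<close>

text \<open>The letter travels leftwards through \<open>w\<close> until it meets a letter that
  emptied \<open>j\<close>, which absorbs it by R1 or R3. Such a letter exists because there are no
  holes at the start.\<close>

lemma idle_move:
  assumes "w \<in> lists (letters I)" "i \<in> I" "j \<in> I" "i \<noteq> j" "j \<notin> img w"
  shows "w @ [(i, j)] \<approx> w"
  using assms
proof (induction w arbitrary: i j rule: rev_induct)
  case Nil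
  then show ?case by simp
next
  case (snoc x w)
  obtain k l where x: "x = (k, l)" by force
  have w: "w \<in> lists (letters I)" and kl: "k \<in> I" "l \<in> I" "k \<noteq> l"
    using snoc.prems(1) x by auto
  note ij = snoc.prems(2-4)
  show ?case
  proof (cases "j = l")
    case True
    have "[(k, l), (i, l)] \<approx> [(k, l)]"
    proof (cases "i = k")
      case True
      then show ?thesis using kl srel_weq[OF s1a[of k l]] by simp
    next
      case False
      then show ?thesis using kl ij True by (intro srel_weq s3) auto
    qed
    from weq_prefix[OF this, of w] show ?thesis using x True by simp
  next
    case jl: False
    show ?thesis
    proof (cases "l \<in> img w")
      case False
      have "w @ [(k, l)] \<approx> w" using snoc.IH[OF w] kl False by simp
      moreover have "w @ [(i, j)] \<approx> w"
        using snoc.IH[OF w] ij snoc.prems(5) False kl x by (simp add: img_snoc)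
      ultimately show ?thesis
        using x weq_suffix[of "w @ [(k, l)]" w "[(i, j)]"] by (meson weq_sym weq_trans)
    next
      case True
      then have jk: "j \<noteq> k" and j: "j \<notin> img w"
        using snoc.prems(5) kl x jl by (auto simp: img_snoc)
      \<comment> \<open>For \<open>i' = l\<close> the two letters do not commute, so this target is
        treated separately below.\<close>
      have swap: "w @ [(k, l), (i', j)] \<approx> w @ [(k, l)]"
        if i': "i' \<in> I" "i' \<noteq> j" "i' \<noteq> l" for i'
      proof -
        have "[(k, l), (i', j)] \<approx> [(i', j), (k, l)]"
        proof (cases "i' = k")
          case True
          then show ?thesis using kl ij jl jk by (intro srel_weq) (auto intro: s4a)
        next
          case False
          then show ?thesis using kl ij jl jk i' by (intro srel_weq s2) auto
        qed
        from weq_prefix[OF this, of w]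
        have "w @ [(k, l), (i', j)] \<approx> (w @ [(i', j)]) @ [(k, l)]" by simp
        also have "\<dots> \<approx> w @ [(k, l)]"
          by (rule weq_suffix, rule snoc.IH) (use w i' ij j in auto)
        finally show ?thesis .
      qed
      show ?thesis
      proof (cases "i = l")
        case False
        then show ?thesis using swap[of i] ij x by simp
      next
        case True
        \<comment> \<open>The letter \<open>(k, j)\<close> is idle by \<open>swap\<close> and can be
          inserted for free; R3 then lets it absorb \<open>(l, j)\<close>.\<close>
        have k: "w @ [(k, l)] \<approx> w @ [(k, l), (k, j)]"
          using swap[of k] kl jk by (auto intro: weq_sym)
        have "w @ [(k, l), (l, j)] \<approx> (w @ [(k, l)]) @ [(k, j), (l, j)]"
          using weq_suffix[OF k, of "[(l, j)]"] by simp
        also have "\<dots> \<approx> (w @ [(k, l)]) @ [(k, j)]"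
          by (intro weq_prefix srel_weq s3) (use kl ij jk jl in auto)
        also have "\<dots> \<approx> w @ [(k, l)]"
          using weq_sym[OF k] by simp
        finally show ?thesis using True x by simp
      qed
    qed
  qed
qed

lemma redirect:
  assumes "{i, j, k} \<subseteq> I" "distinct [i, j, k]"
  shows "[(i, k), (i, j)] \<approx> [(j, k), (i, j)]" "[(i, j), (i, k)] \<approx> [(j, k), (i, j)]"
proof -
  show *: "[(i, k), (i, j)] \<approx> [(j, k), (i, j)]"
    by (intro srel_weq s4b) (use assms in auto)
  have "[(i, j), (i, k)] \<approx> [(i, k), (i, j)]"
    by (intro srel_weq s4a) (use assms in auto)
  with * show "[(i, j), (i, k)] \<approx> [(j, k), (i, j)]"
    by (rule weq_trans[rotated])
qed

text \<open>R4 turns the first letter into the direct move \<open>(k, j)\<close>; the position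
  \<open>i\<close> is then still a hole, so \<open>(k, i)\<close> is idle.\<close>

lemma move_through_hole:
  assumes w: "w \<in> lists (letters I)" and I: "{i, j, k} \<subseteq> I" "distinct [i, j, k]"
    and i: "i \<notin> img w"
  shows "w @ [(i, j), (k, i)] \<approx> w @ [(k, j)]"
proof -
  have "w @ [(i, j), (k, i)] \<approx> w @ [(k, j), (k, i)]"
    by (rule weq_prefix, rule weq_sym, rule redirect) (use I in auto)
  also have "\<dots> \<approx> w @ [(k, j)]"
    using idle_move[of "w @ [(k, j)]" k i] w I i by (auto simp: img_snoc)
  finally show ?thesis .
qed

text \<open>R1 deletes \<open>(i, j)\<close> in front of \<open>(j, i)\<close>, and the remaining
  letter starts from the hole \<open>i\<close>.\<close>

lemma move_back:
  assumes w: "w \<in> lists (letters I)" and I: "{i, j} \<subseteq> I" "i \<noteq> j" and i: "i \<notin> img w"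
  shows "w @ [(i, j), (j, i)] \<approx> w"
proof -
  have "w @ [(i, j), (j, i)] \<approx> w @ [(j, i)]"
    by (rule weq_prefix, rule weq_sym, rule srel_weq, rule s1b) (use I in auto)
  also have "\<dots> \<approx> w"
    using idle_move[of w j i] w I i by auto
  finally show ?thesis .
qed

lemma disjoint_commute:
  "{i, j, k, l} \<subseteq> I \<Longrightarrow> distinct [i, j, k, l] \<Longrightarrow> [(i, j), (k, l)] \<approx> [(k, l), (i, j)]"
  by (intro srel_weq s2)

text \<open>Both ways round the triangle interchange the tokens at \<open>j\<close> and
  \<open>k\<close>. An idle \<open>(k, i)\<close> in front creates the left side of R5, and the
  \<open>(k, i)\<close> at the end cancels the last letter of its right side.\<close>

lemma three_cycle:
  assumes w: "w \<in> lists (letters I)" and I: "{i, j, k} \<subseteq> I" "distinct [i, j, k]"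
    and i: "i \<notin> img w"
  shows "w @ [(i, j), (j, k), (k, i)] \<approx> w @ [(i, k), (k, j), (j, i)]"
proof -
  have "w @ [(i, j), (j, k), (k, i)] \<approx> (w @ [(k, i)]) @ [(i, j), (j, k), (k, i)]"
    by (rule weq_suffix, rule weq_sym, rule idle_move) (use w I i in auto)
  also have "\<dots> = w @ [(k, i), (i, j), (j, k)] @ [(k, i)]"
    by simp
  also have "\<dots> \<approx> w @ [(i, k), (k, j), (j, i), (i, k)] @ [(k, i)]"
    by (rule weq_append, rule srel_weq, rule s5) (use I in auto)
  also have "\<dots> = (w @ [(i, k), (k, j), (j, i)]) @ [(i, k), (k, i)]"
    by simp
  also have "\<dots> \<approx> w @ [(i, k), (k, j), (j, i)]"
    by (rule move_back) (use w I i in \<open>auto simp: img_append\<close>)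
  finally show ?thesis .
qed

text \<open>This is R6, its left side completed by an idle \<open>(k, i)\<close>.\<close>

lemma four_cycle:
  assumes w: "w \<in> lists (letters I)" and I: "{i, j, k, l} \<subseteq> I" "distinct [i, j, k, l]"
    and i: "i \<notin> img w"
  shows "w @ [(i, j), (j, k), (k, l)] \<approx> w @ [(i, k), (k, l), (l, i), (i, j), (j, l)]"
proof -
  have "w @ [(i, j), (j, k), (k, l)] \<approx> (w @ [(k, i)]) @ [(i, j), (j, k), (k, l)]"
    by (rule weq_suffix, rule weq_sym, rule idle_move) (use w I i in auto)
  also have "\<dots> = w @ [(k, i), (i, j), (j, k), (k, l)]"
    by simp
  also have "\<dots> \<approx> w @ [(i, k), (k, l), (l, i), (i, j), (j, l)]"
    by (rule weq_prefix, rule srel_weq, rule s6) (use I in auto)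
  finally show ?thesis .
qed

section \<open>Triviality of closed slide sequences\<close>

text \<open>After \<open>v\<close>, the token at \<open>p\<close> stays, or slides to a hole
  \<open>q\<close>, or slides to \<open>q\<close> and lets the token of \<open>r\<close> take its
  place. Up to letters avoiding \<open>p\<close>, these patterns are closed under appending a
  slide.\<close>

definition detours :: "nat set \<Rightarrow> nat \<Rightarrow> (nat \<times> nat) list \<Rightarrow> (nat \<times> nat) list set" where
  "detours P p v = {[]} \<union> {[(q, p)] | q. q \<in> P - {p} \<and> q \<notin> img v} \<union>
    {[(q, p), (p, r)] | q r. q \<in> P - {p} \<and> r \<in> P - {p} \<and> q \<noteq> r \<and> q \<notin> img v \<and> r \<in> img v}"

text \<open>The new slide is combined with each of the three detours; whatever avoids
  \<open>p\<close> is moved to the left into \<open>u\<close>, and what remains is again a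
  detour.\<close>

lemma detours_step:
  assumes v: "v \<in> lists (letters I)" and P: "P \<subseteq> I" and p: "p \<in> P" "p \<in> img v"
    and c: "c \<in> detours P p v" and ij: "i \<in> P" "j \<in> P" "i \<noteq> j"
    and i: "i \<notin> img (v @ c)" and j: "j \<in> img (v @ c)"
  shows "\<exists>u \<in> lists (letters (P - {p})). \<exists>c' \<in> detours P p (v @ u). v @ c @ [(i, j)] \<approx> v @ u @ c'"
proof -
  consider "c = []" | q where "c = [(q, p)]" "q \<in> P - {p}" "q \<notin> img v"
    | q r where "c = [(q, p), (p, r)]" "q \<in> P - {p}" "r \<in> P - {p}" "q \<noteq> r" "q \<notin> img v" "r \<in> img v"
    using c by (auto simp: detours_def)
  then show ?thesis
  proof cases
    case 1
    then have "i \<noteq> p" "i \<notin> img v" using i p by auto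
    show ?thesis
    proof (cases "j = p")
      case True
      then have "[(i, j)] \<in> detours P p (v @ [])"
        using \<open>i \<noteq> p\<close> \<open>i \<notin> img v\<close> ij by (auto simp: detours_def)
      then show ?thesis using 1 by (intro bexI[of _ "[]"] bexI[of _ "[(i, j)]"]) auto
    next
      case False
      have "[] \<in> detours P p (v @ [(i, j)])" by (simp add: detours_def)
      then show ?thesis using 1 False \<open>i \<noteq> p\<close> ij
        by (intro bexI[of _ "[(i, j)]"] bexI[of _ "[]"]) auto
    qed
  next
    case (2 q)
    then have img_vc: "img (v @ c) = insert q (img v - {p})"
      using p by (auto simp: img_snoc)
    \<comment> \<open>If \<open>j = q\<close>, the token displaced from \<open>p\<close> moves on:
      it returns home or is sent to \<open>i\<close> directly. Otherwise a slide into
      \<open>p\<close> completes the two-letter detour, and any other slide is disjoint from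
      \<open>(q, p)\<close>.\<close>
    show ?thesis
    proof (cases "j = q")
      case jq: True
      show ?thesis
      proof (cases "i = p")
        case True
        have "v @ [(q, p), (p, q)] \<approx> v"
          by (rule move_back) (use v P p 2 in auto)
        moreover have "[] \<in> detours P p (v @ [])" by (simp add: detours_def)
        ultimately show ?thesis using 2 True jq
          by (intro bexI[of _ "[]"] bexI[of _ "[]"]) auto
      next
        case False
        have "v @ [(q, p), (i, q)] \<approx> v @ [(i, p)]"
          by (rule move_through_hole) (use v P p 2 False ij jq in auto)
        moreover have "[(i, p)] \<in> detours P p (v @ [])"
          using False ij i img_vc by (auto simp: detours_def)
        ultimately show ?thesis using 2 jq
          by (intro bexI[of _ "[]"] bexI[of _ "[(i, p)]"]) auto
      qed
    next
      case jq: False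
      have jp: "j \<noteq> p" "j \<in> img v" using j img_vc jq by auto
      show ?thesis
      proof (cases "i = p")
        case True
        have "[(q, p), (p, j)] \<in> detours P p (v @ [])"
          using 2 jq jp ij by (auto simp: detours_def)
        then show ?thesis using 2 True
          by (intro bexI[of _ "[]"] bexI[of _ "[(q, p), (p, j)]"]) auto
      next
        case False
        have iq: "i \<noteq> q" "i \<notin> img v" using i img_vc False by auto
        have "[(q, p), (i, j)] \<approx> [(i, j), (q, p)]"
          by (rule disjoint_commute) (use 2 P p ij iq jq jp False in auto)
        from weq_prefix[OF this, of v]
        have "v @ [(q, p), (i, j)] \<approx> v @ [(i, j), (q, p)]" .
        moreover have "[(q, p)] \<in> detours P p (v @ [(i, j)])"
          using 2 iq ij by (auto simp: detours_def img_snoc)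
        ultimately show ?thesis using 2 False jp ij
          by (intro bexI[of _ "[(i, j)]"] bexI[of _ "[(q, p)]"]) auto
      qed
    qed
  next
    case (3 q r)
    have "img (v @ c) = insert p (insert q (img v - {p}) - {r})"
      using img_snoc[of p r "v @ [(q, p)]"] img_snoc[of q p v] 3 p by auto
    then have img_vc: "img (v @ c) = insert q (img v - {r})"
      using 3 p by auto
    have ipq: "i \<noteq> p" "i \<noteq> q" using i img_vc 3 p by auto
    \<comment> \<open>The detour leaves a hole at \<open>r\<close>. If the new slide fills another
      hole \<open>i\<close>, the token of \<open>r\<close> is first brought to \<open>i\<close> by
      \<open>v0\<close>, which avoids \<open>p\<close>; the detour can then use \<open>i\<close> in
      place of \<open>r\<close>.\<close>
    have hole: "\<exists>v0. v0 \<in> lists (letters (P - {p})) \<and> q \<notin> img (v @ v0) \<and> i \<in> img (v @ v0) \<and>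
        img (v @ v0) - {i} = img v - {r} \<and> v @ c \<approx> v @ v0 @ [(q, p), (p, i)]"
    proof (cases "i = r")
      case True
      then show ?thesis using 3 by (intro exI[of _ "[]"]) auto
    next
      case False
      have iv: "i \<notin> img v" using i img_vc ipq False by auto
      have "v @ [(i, r), (q, p), (p, i)] \<approx> v @ [(q, p), (i, r), (p, i)]"
        using weq_append[OF disjoint_commute[of i r q p], of v "[(p, i)]"] 3 P p ij ipq False by auto
      also have "\<dots> = (v @ [(q, p)]) @ [(i, r), (p, i)]" by simp
      also have "\<dots> \<approx> (v @ [(q, p)]) @ [(p, r)]"
        by (rule move_through_hole) (use v 3 P p ij ipq False iv in \<open>auto simp: img_snoc\<close>)
      finally have "v @ [(q, p), (p, r)] \<approx> v @ [(i, r), (q, p), (p, i)]"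
        by (simp add: weq_sym)
      then show ?thesis using 3 False iv ipq ij
        by (intro exI[of _ "[(i, r)]"]) (auto simp: img_snoc)
    qed
    from hole obtain v0 where v0: "v0 \<in> lists (letters (P - {p}))" "q \<notin> img (v @ v0)" "i \<in> img (v @ v0)"
        "img (v @ v0) - {i} = img v - {r}" "v @ c \<approx> v @ v0 @ [(q, p), (p, i)]"
      by blast
    define v1 where "v1 = v @ v0"
    have v1: "v1 \<in> lists (letters I)"
      using v v0(1) P by (auto simp: v1_def letters_def)
    have img_v1: "img (v @ c) = insert q (img v1 - {i})"
      using img_vc v0 by (simp add: v1_def)
    have qv1: "q \<notin> img v1" "i \<in> img v1" using v0 by (auto simp: v1_def)
    have pv1: "p \<in> img v1"
    proof -
      have "p \<in> img v - {r}" using p 3 by auto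
      then show ?thesis using v0(4) by (auto simp: v1_def)
    qed
    have start: "v @ c @ [(i, j)] \<approx> v1 @ [(q, p), (p, i), (i, j)]"
      using weq_suffix[OF v0(5), of "[(i, j)]"] by (simp add: v1_def)
    show ?thesis
    proof (cases "j = p")
      case True
      \<comment> \<open>The second half of the detour is undone, leaving the one-letter
        detour.\<close>
      have "(v1 @ [(q, p)]) @ [(p, i), (i, p)] \<approx> v1 @ [(q, p)]"
        by (rule move_back) (use v1 3 P p ij ipq in \<open>auto simp: img_snoc\<close>)
      with start have "v @ c @ [(i, j)] \<approx> v @ v0 @ [(q, p)]"
        using True by (auto simp: v1_def intro: weq_trans)
      moreover have "[(q, p)] \<in> detours P p (v @ v0)"
        using 3 v0 by (auto simp: detours_def)
      ultimately show ?thesis using v0(1) by blast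
    next
      case jp: False
      show ?thesis
      proof (cases "j = q")
        case True
        \<comment> \<open>Reversing the triangle puts a letter avoiding \<open>p\<close> first and a
          two-letter detour after it; this is where R5 enters.\<close>
        have "v1 @ [(q, p), (p, i), (i, q)] \<approx> v1 @ [(q, i), (i, p), (p, q)]"
          by (rule three_cycle) (use v1 3 P p ij ipq qv1 in auto)
        with start have "v @ c @ [(i, j)] \<approx> v @ (v0 @ [(q, i)]) @ [(i, p), (p, q)]"
          using True by (auto simp: v1_def intro: weq_trans)
        moreover have "[(i, p), (p, q)] \<in> detours P p (v @ (v0 @ [(q, i)]))"
          using 3 v0 ij ipq img_snoc[of q i "v @ v0"] by (auto simp: detours_def)
        moreover have "v0 @ [(q, i)] \<in> lists (letters (P - {p}))"
          using v0(1) 3 ij ipq by auto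
        ultimately show ?thesis by blast
      next
        case jq: False
        have jv1: "j \<in> img v1" using j img_v1 jq by auto
        \<comment> \<open>With four distinct positions R6 applies: the first three letters of the
          new word avoid \<open>p\<close>, the last two form a detour.\<close>
        have "v1 @ [(q, p), (p, i), (i, j)] \<approx> v1 @ [(q, i), (i, j), (j, q), (q, p), (p, j)]"
          by (rule four_cycle) (use v1 3 P p ij ipq qv1 jp jq in auto)
        with start have eq: "v @ c @ [(i, j)] \<approx> v @ (v0 @ [(q, i), (i, j), (j, q)]) @ [(q, p), (p, j)]"
          by (auto simp: v1_def intro: weq_trans)
        have "img (v1 @ [(q, i)]) = insert q (img v1 - {i})"
          using img_snoc[of q i v1] qv1 ipq by auto
        moreover have "img ((v1 @ [(q, i)]) @ [(i, j)]) = insert i (img (v1 @ [(q, i)]) - {j})"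
          using img_snoc[of i j "v1 @ [(q, i)]"] jv1 ij jq calculation by auto
        moreover have "img ((v1 @ [(q, i), (i, j)]) @ [(j, q)]) = insert j (img (v1 @ [(q, i), (i, j)]) - {q})"
          using img_snoc[of j q "v1 @ [(q, i), (i, j)]"] jq calculation by auto
        ultimately have "q \<notin> img (v1 @ [(q, i), (i, j), (j, q)])" "j \<in> img (v1 @ [(q, i), (i, j), (j, q)])"
          using jq by auto
        then have "[(q, p), (p, j)] \<in> detours P p (v @ (v0 @ [(q, i), (i, j), (j, q)]))"
          using 3 ij jp jq by (auto simp: detours_def v1_def)
        moreover have "v0 @ [(q, i), (i, j), (j, q)] \<in> lists (letters (P - {p}))"
          using v0(1) 3 ij ipq jp jq by auto
        ultimately show ?thesis using eq by blast
      qed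
    qed
  qed
qed

text \<open>Moving a token onto an occupied position would identify two tokens.\<close>

lemma moved_into_hole:
  assumes inj: "inj_on (act (u @ [(i, j)])) (img w)" and ij: "i \<noteq> j" and j: "j \<in> img (w @ u)"
  shows "i \<notin> img (w @ u)"
proof
  assume "i \<in> img (w @ u)"
  with j obtain y z where yz: "y \<in> img w" "act u y = i" "z \<in> img w" "act u z = j"
    by (auto simp: img_append)
  then have "y = z"
    using inj_onD[OF inj, of y z] by simp
  then show False using yz ij by auto
qed

text \<open>Induction along \<open>u\<close>: an idle letter is dropped, and by injectivity every
  other letter is a slide into a hole, which \<open>detours_step\<close> absorbs.\<close>

lemma detours_factor:
  assumes w: "w \<in> lists (letters I)" and P: "P \<subseteq> I" and p: "p \<in> P" "p \<in> img w"
  shows "u \<in> lists (letters P) \<Longrightarrow> inj_on (act u) (img w) \<Longrightarrow>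
    \<exists>u' \<in> lists (letters (P - {p})). \<exists>c \<in> detours P p (w @ u'). w @ u \<approx> w @ u' @ c"
proof (induction u rule: rev_induct)
  case Nil
  then show ?case
    by (intro bexI[of _ "[]"]) (auto simp: detours_def)
next
  case (snoc x u)
  obtain i j where x: "x = (i, j)" by force
  have u: "u \<in> lists (letters P)" and ij: "i \<in> P" "j \<in> P" "i \<noteq> j"
    using snoc.prems(1) x by auto
  have "inj_on (act u) (img w)"
    using snoc.prems(2) unfolding inj_on_def by simp
  from snoc.IH[OF u this] obtain u' c where u': "u' \<in> lists (letters (P - {p}))"
    and c: "c \<in> detours P p (w @ u')" and eq: "w @ u \<approx> w @ u' @ c"
    by blast
  have wu: "w @ u \<in> lists (letters I)"
    using w u P by (auto simp: letters_def)
  show ?case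
  proof (cases "j \<in> img (w @ u)")
    case False
    have "(w @ u) @ [(i, j)] \<approx> w @ u"
      by (rule idle_move) (use wu ij P False in auto)
    then have "w @ (u @ [x]) \<approx> w @ u' @ c"
      using eq x by (auto intro: weq_trans)
    then show ?thesis using u' c by blast
  next
    case True
    have "i \<notin> img (w @ u)"
      by (rule moved_into_hole[OF snoc.prems(2)[unfolded x] ij(3) True])
    moreover have "img (w @ u) = img ((w @ u') @ c)"
      using weq_img[OF eq] by simp
    moreover have "p \<in> img (w @ u')"
      using imageI[OF p(2), of "act u'"] act_outside[OF u', of p] by (simp add: img_append)
    moreover have "w @ u' \<in> lists (letters I)"
      using w u' P by (auto simp: letters_def)
    ultimately have "\<exists>u'' \<in> lists (letters (P - {p})). \<exists>c' \<in> detours P p ((w @ u') @ u'').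
        (w @ u') @ c @ [(i, j)] \<approx> (w @ u') @ u'' @ c'"
      using True by (intro detours_step P p(1) c ij) simp_all
    then obtain u'' c' where u'': "u'' \<in> lists (letters (P - {p}))"
        "c' \<in> detours P p ((w @ u') @ u'')" "(w @ u') @ c @ [(i, j)] \<approx> (w @ u') @ u'' @ c'"
      by blast
    have "w @ (u @ [x]) \<approx> w @ (u' @ u'') @ c'"
      using weq_suffix[OF eq, of "[x]"] u''(3) x by (auto intro: weq_trans)
    moreover have "u' @ u'' \<in> lists (letters (P - {p}))"
      using u' u'' by auto
    ultimately show ?thesis using u''(2)
      by (intro bexI[of _ "u' @ u''"] bexI[of _ c']) auto
  qed
qed

text \<open>Occupied positions are removed from \<open>P\<close> one at a time by
  \<open>detours_factor\<close>. Once \<open>P\<close> contains holes only, every letter of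
  \<open>u\<close> is idle.\<close>

lemma loop_trivial:
  assumes w: "w \<in> lists (letters I)"
  shows "P \<subseteq> I \<Longrightarrow> u \<in> lists (letters P) \<Longrightarrow> (\<And>x. x \<in> img w \<Longrightarrow> act u x = x) \<Longrightarrow> w @ u \<approx> w"
proof (induction "card P" arbitrary: P u rule: less_induct)
  case less
  show ?case
  proof (cases "P \<inter> img w = {}")
    case True
    from less.prems(2) show ?thesis
    proof (induction u rule: rev_induct)
      case (snoc x u)
      obtain i j where x: "x = (i, j)" by force
      have eq: "w @ u \<approx> w" using snoc by simp
      have "w @ [(i, j)] \<approx> w"
        by (rule idle_move) (use w snoc.prems less.prems(1) x True in auto)
      then show ?case
        using weq_suffix[OF eq, of "[(i, j)]"] x by (auto intro: weq_trans)
    qed simp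
  next
    case False
    then obtain p where p: "p \<in> P" "p \<in> img w" by blast
    have "inj_on (act u) (img w)"
      using less.prems(3) by (simp add: inj_on_def)
    with detours_factor[OF w less.prems(1) p less.prems(2)] obtain u' c
      where u': "u' \<in> lists (letters (P - {p}))" and c: "c \<in> detours P p (w @ u')"
        and eq: "w @ u \<approx> w @ u' @ c"
      by blast
    have act: "act c (act u' x) = x" if x: "x \<in> img w" for x
    proof -
      obtain y where "y \<in> I" "x = act w y" using x by (auto simp: img_def)
      then show ?thesis
        using fun_cong[OF weq_act[OF eq], of y] less.prems(3)[OF x] by simp
    qed
    \<comment> \<open>The loop fixes \<open>p\<close>, and so does \<open>u'\<close>, which avoids
      it. Both nonempty kinds of detour carry \<open>p\<close> to some \<open>q \<noteq> p\<close>,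
      so the detour is empty.\<close>
    have "act c p = p"
      using act[OF p(2)] act_outside[OF u', of p] by simp
    then have "c = []"
      using c by (auto simp: detours_def split: if_splits)
    have "w @ u' \<approx> w"
    proof (rule less.hyps)
      show "card (P - {p}) < card P"
        using p less.prems(1) finite_I by (meson card_Diff1_less finite_subset)
      show "act u' x = x" if "x \<in> img w" for x
        using act[OF that] \<open>c = []\<close> by simp
    qed (use less.prems(1) u' in auto)
    then show ?thesis
      using eq \<open>c = []\<close> by (auto intro: weq_trans)
  qed
qed

text \<open>The slides are undone in reverse order and idle letters are skipped. The letter
  \<open>(j, i)\<close> undoes \<open>(i, j)\<close> because \<open>i\<close> was a hole, so no
  other token sits there.\<close>

lemma reverse_moves:
  assumes "w \<in> lists (letters I)"
  shows "u \<in> lists (letters I) \<Longrightarrow> inj_on (act u) (img w) \<Longrightarrow>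
    \<exists>r \<in> lists (letters I). \<forall>x \<in> img w. act (u @ r) x = x"
proof (induction u rule: rev_induct)
  case Nil
  then show ?case by (intro bexI[of _ "[]"]) auto
next
  case (snoc y u)
  obtain i j where y: "y = (i, j)" by force
  have u: "u \<in> lists (letters I)" and ij: "i \<in> I" "j \<in> I" "i \<noteq> j"
    using snoc.prems(1) y by auto
  have "inj_on (act u) (img w)"
    using snoc.prems(2) unfolding inj_on_def by simp
  from snoc.IH[OF u this] obtain r where r: "r \<in> lists (letters I)"
    "\<And>x. x \<in> img w \<Longrightarrow> act r (act u x) = x" by auto
  show ?case
  proof (cases "j \<in> img (w @ u)")
    case False
    then have "\<forall>x \<in> img w. act ((u @ [y]) @ r) x = x"
      using r(2) y by (auto simp: img_append)
    then show ?thesis using r(1) by blast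
  next
    case True
    have "i \<notin> img (w @ u)"
      by (rule moved_into_hole[OF snoc.prems(2)[unfolded y] ij(3) True])
    then have "act u x \<noteq> i" if "x \<in> img w" for x
      using that by (auto simp: img_append)
    then have "\<forall>x \<in> img w. act ((u @ [y]) @ (j, i) # r) x = x"
      using r(2) y by auto
    then show ?thesis using r(1) ij by (intro bexI[of _ "(j, i) # r"]) auto
  qed
qed

text \<open>With \<open>r\<close> undoing \<open>u\<close>, the word \<open>w @ u @ r @ v\<close> is
  read in two ways: \<open>u @ r\<close> is a loop after \<open>w\<close>, and \<open>r @ v\<close>
  is a loop after \<open>w @ u\<close>.\<close>

lemma moves_unique:
  assumes w: "w \<in> lists (letters I)" and u: "u \<in> lists (letters I)" and v: "v \<in> lists (letters I)"
    and inj: "inj_on (act u) (img w)" and eq: "\<And>x. x \<in> img w \<Longrightarrow> act u x = act v x"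
  shows "w @ u \<approx> w @ v"
proof -
  obtain r where r: "r \<in> lists (letters I)" "\<And>x. x \<in> img w \<Longrightarrow> act r (act u x) = x"
    using reverse_moves[OF w u inj] by auto
  have "(w @ u) @ (r @ v) \<approx> w @ u"
    by (rule loop_trivial[where P = I]) (use w u v r eq in \<open>auto simp: img_append\<close>)
  moreover have "w @ (u @ r) \<approx> w"
    by (rule loop_trivial[where P = I]) (use w u v r eq in auto)
  from weq_suffix[OF this, of v] have "(w @ u) @ (r @ v) \<approx> w @ v" by simp
  ultimately show ?thesis by (meson weq_sym weq_trans)
qed

section \<open>Normal forms\<close>

text \<open>Two tokens can be merged before the slides that bring them to \<open>i\<close> and
  \<open>j\<close>: the merge passes the slides from right to left. That the remaining word
  \<open>u'\<close> is injective is obtained later by counting, in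
  \<open>normal_form_merge\<close>.\<close>

lemma merge_before_moves:
  assumes w: "w \<in> lists (letters I)"
  shows "u \<in> lists (letters I) \<Longrightarrow> inj_on (act u) (img w) \<Longrightarrow>
    i \<in> img (w @ u) \<Longrightarrow> j \<in> img (w @ u) \<Longrightarrow> i \<noteq> j \<Longrightarrow>
    \<exists>k \<in> img w. \<exists>l \<in> img w. \<exists>u' \<in> lists (letters I). k \<noteq> l \<and> w @ u @ [(i, j)] \<approx> w @ (k, l) # u'"
proof (induction u arbitrary: i j rule: rev_induct)
  case Nil
  show ?case
    by (rule bexI[of _ i], rule bexI[of _ j], rule bexI[of _ "[]"]) (use Nil in auto)
next
  case (snoc x u)
  obtain a b where x: "x = (a, b)" by force
  have u: "u \<in> lists (letters I)" and ab: "a \<in> I" "b \<in> I" "a \<noteq> b"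
    using snoc.prems(1) x by auto
  have wu: "w @ u \<in> lists (letters I)" using w u by simp
  have inj: "inj_on (act u) (img w)"
    using snoc.prems(2) unfolding inj_on_def by simp
  have img_x: "img (w @ u @ [x]) = (if b \<in> img (w @ u) then insert a (img (w @ u) - {b}) else img (w @ u))"
    using img_snoc[of a b "w @ u"] ab x by simp
  have "img (w @ u @ [x]) \<subseteq> I"
    by (rule img_subset) (use w snoc.prems(1) in simp)
  then have ij: "i \<in> I" "j \<in> I" "i \<noteq> j"
    using snoc.prems by auto
  show ?case
  proof (cases "b \<in> img (w @ u)")
    case False
    have "(w @ u) @ [(a, b)] \<approx> w @ u"
      by (rule idle_move) (use wu ab False in auto)
    then have "w @ (u @ [x]) @ [(i, j)] \<approx> w @ u @ [(i, j)]"
      using weq_suffix[of "(w @ u) @ [(a, b)]" "w @ u" "[(i, j)]"] x by simp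
    moreover have "i \<in> img (w @ u)" "j \<in> img (w @ u)"
      using snoc.prems img_x False by auto
    ultimately show ?thesis
      using snoc.IH[OF u inj, of i j] ij by (meson weq_trans)
  next
    case True
    have a: "a \<notin> img (w @ u)"
      by (rule moved_into_hole[OF snoc.prems(2)[unfolded x] ab(3) True])
    have ijb: "i \<noteq> b" "j \<noteq> b" "i = a \<or> i \<in> img (w @ u)" "j = a \<or> j \<in> img (w @ u)"
      using snoc.prems img_x True ab by auto
    have "\<exists>i' \<in> img (w @ u). \<exists>j' \<in> img (w @ u). \<exists>c \<in> lists (letters I). i' \<noteq> j' \<and>
        (w @ u) @ [(a, b), (i, j)] \<approx> (w @ u) @ [(i', j')] @ c"
    proof -
      \<comment> \<open>The token now at \<open>a\<close> stood at \<open>b\<close> before the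
        slide, so \<open>b\<close> replaces \<open>a\<close> in the merge: by R4 if \<open>a\<close>
        is its target, by \<open>move_through_hole\<close> if \<open>a\<close> is its source.
        Otherwise the two letters are disjoint.\<close>
      consider "i = a" | "j = a" | "i \<noteq> a" "j \<noteq> a" by blast
      then show ?thesis
      proof cases
        case 1
        have "[(a, b), (a, j)] \<approx> [(b, j), (a, b)]"
          by (rule redirect) (use 1 ab ij ijb in auto)
        from weq_prefix[OF this, of "w @ u"]
        show ?thesis using 1 ab ij ijb True
          by (intro bexI[of _ b] bexI[of _ j] bexI[of _ "[(a, b)]"]) auto
      next
        case 2
        have "(w @ u) @ [(a, b), (i, a)] \<approx> (w @ u) @ [(i, b)]"
          by (rule move_through_hole) (use 2 wu ab ij ijb a in auto)
        then show ?thesis using 2 ab ij ijb True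
          by (intro bexI[of _ i] bexI[of _ b] bexI[of _ "[]"]) auto
      next
        case 3
        have "[(a, b), (i, j)] \<approx> [(i, j), (a, b)]"
          by (rule disjoint_commute) (use 3 ab ij ijb in auto)
        from weq_prefix[OF this, of "w @ u"]
        show ?thesis using 3 ab ij ijb
          by (intro bexI[of _ i] bexI[of _ j] bexI[of _ "[(a, b)]"]) auto
      qed
    qed
    then obtain i' j' c where c: "i' \<in> img (w @ u)" "j' \<in> img (w @ u)" "c \<in> lists (letters I)"
        "i' \<noteq> j'" "(w @ u) @ [(a, b), (i, j)] \<approx> (w @ u) @ [(i', j')] @ c"
      by blast
    from snoc.IH[OF u inj c(1,2,4)] obtain k l u' where u': "k \<in> img w" "l \<in> img w"
        "u' \<in> lists (letters I)" "k \<noteq> l" "w @ u @ [(i', j')] \<approx> w @ (k, l) # u'"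
      by blast
    have "w @ (u @ [x]) @ [(i, j)] \<approx> w @ (k, l) # (u' @ c)"
      using c(5) weq_suffix[OF u'(5), of c] x by (auto intro: weq_trans)
    moreover have "u' @ c \<in> lists (letters I)" using u' c by simp
    ultimately show ?thesis using u' by blast
  qed
qed

section \<open>Retractions and their merge words\<close>

definition retraction :: "(nat \<Rightarrow> nat) \<Rightarrow> bool" where
  "retraction \<alpha> \<longleftrightarrow> \<alpha> \<in> I \<rightarrow> I \<and> (\<forall>x \<in> I. \<alpha> (\<alpha> x) = \<alpha> x)"

definition merges :: "(nat \<Rightarrow> nat) \<Rightarrow> nat list \<Rightarrow> (nat \<times> nat) list" where
  "merges \<alpha> L = map (\<lambda>x. (\<alpha> x, x)) L"

lemma merges_simps [simp]:
  "merges \<alpha> [] = []" "merges \<alpha> (x # L) = (\<alpha> x, x) # merges \<alpha> L"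
  "merges \<alpha> (K @ L) = merges \<alpha> K @ merges \<alpha> L"
  by (simp_all add: merges_def)

lemma merges_letters:
  "retraction \<alpha> \<Longrightarrow> set L \<subseteq> {x \<in> I. \<alpha> x \<noteq> x} \<Longrightarrow> merges \<alpha> L \<in> lists (letters I)"
  by (induction L) (auto simp: retraction_def)

lemma act_merges_subset:
  "retraction \<alpha> \<Longrightarrow> set L \<subseteq> {x \<in> I. \<alpha> x \<noteq> x} \<Longrightarrow>
    act (merges \<alpha> L) y = (if y \<in> set L then \<alpha> y else y)"
proof (induction L arbitrary: y)
  case (Cons x L)
  \<comment> \<open>Targets are fixed points of \<open>\<alpha>\<close> while \<open>L\<close> lists
    points that are not fixed, so a merged token is never moved again.\<close>
  have "\<alpha> x \<notin> set L"
    using Cons.prems by (auto simp: retraction_def)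
  then show ?case using Cons by auto
qed simp

lemma act_merges:
  "retraction \<alpha> \<Longrightarrow> set L = {x \<in> I. \<alpha> x \<noteq> x} \<Longrightarrow> x \<in> I \<Longrightarrow> act (merges \<alpha> L) x = \<alpha> x"
  by (auto simp: act_merges_subset)

lemma img_merges: "retraction \<alpha> \<Longrightarrow> set L = {x \<in> I. \<alpha> x \<noteq> x} \<Longrightarrow> img (merges \<alpha> L) = \<alpha> ` I"
  by (simp add: img_def act_merges cong: image_cong)

text \<open>The letters commute pairwise: by R4 if they share a target, and otherwise by R2, as no
  target is a source.\<close>

lemma merges_to_front:
  assumes \<alpha>: "retraction \<alpha>"
  shows "set (K @ [x]) \<subseteq> {x \<in> I. \<alpha> x \<noteq> x} \<Longrightarrow> x \<notin> set K \<Longrightarrow>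
    merges \<alpha> (K @ [x]) \<approx> merges \<alpha> (x # K)"
proof (induction K)
  case (Cons y K)
  have xy: "x \<in> I" "y \<in> I" "\<alpha> x \<in> I" "\<alpha> y \<in> I" "\<alpha> x \<noteq> x" "\<alpha> y \<noteq> y" "x \<noteq> y"
    using Cons.prems \<alpha> by (auto simp: retraction_def)
  have neq: "\<alpha> x \<noteq> y" "\<alpha> y \<noteq> x"
    using xy \<alpha> by (auto simp: retraction_def)
  have "[(\<alpha> y, y), (\<alpha> x, x)] \<approx> [(\<alpha> x, x), (\<alpha> y, y)]"
  proof (cases "\<alpha> x = \<alpha> y")
    case True
    have "[(\<alpha> y, y), (\<alpha> y, x)] \<approx> [(\<alpha> y, x), (\<alpha> y, y)]"
      by (rule srel_weq, rule s4a) (use xy neq True in auto)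
    then show ?thesis using True by simp
  next
    case False
    show ?thesis by (rule disjoint_commute) (use xy neq False in auto)
  qed
  from weq_suffix[OF this, of "merges \<alpha> K"]
  have "(\<alpha> y, y) # merges \<alpha> (x # K) \<approx> merges \<alpha> (x # y # K)" by simp
  moreover have "merges \<alpha> (K @ [x]) \<approx> merges \<alpha> (x # K)"
    using Cons by auto
  from weq_prefix[OF this, of "[(\<alpha> y, y)]"]
  have "merges \<alpha> ((y # K) @ [x]) \<approx> (\<alpha> y, y) # merges \<alpha> (x # K)" by simp
  ultimately show ?case by (rule weq_trans[rotated])
qed simp

lemma merges_permute:
  assumes \<alpha>: "retraction \<alpha>"
  shows "set L \<subseteq> {x \<in> I. \<alpha> x \<noteq> x} \<Longrightarrow> distinct L \<Longrightarrow> distinct K \<Longrightarrow> set K = set L \<Longrightarrow>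
    merges \<alpha> L \<approx> merges \<alpha> K"
proof (induction K arbitrary: L)
  case (Cons x K)
  then obtain L1 L2 where L: "L = L1 @ x # L2"
    by (metis list.set_intros(1) split_list)
  have "merges \<alpha> (L1 @ [x]) \<approx> merges \<alpha> (x # L1)"
    by (rule merges_to_front[OF \<alpha>]) (use Cons.prems L in auto)
  from weq_suffix[OF this, of "merges \<alpha> L2"]
  have "merges \<alpha> L \<approx> [(\<alpha> x, x)] @ merges \<alpha> (L1 @ L2)" using L by simp
  also have "\<dots> \<approx> [(\<alpha> x, x)] @ merges \<alpha> K"
    by (rule weq_prefix, rule Cons.IH) (use Cons.prems L in auto)
  finally show ?case by simp
qed simp

text \<open>The new merge passes every letter to the left; a letter with target \<open>l\<close> is
  thereby redirected to \<open>k\<close>, which is exactly the change from \<open>\<alpha>\<close>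
  to \<open>\<alpha>'\<close>.\<close>

lemma merges_snoc:
  assumes \<alpha>: "retraction \<alpha>" and kl: "k \<in> I" "l \<in> I" "k \<noteq> l" "\<alpha> k = k" "\<alpha> l = l"
    and \<alpha>': "\<alpha>' = (\<lambda>x. if \<alpha> x = l then k else \<alpha> x)"
  shows "set L \<subseteq> {x \<in> I. \<alpha> x \<noteq> x} \<Longrightarrow> merges \<alpha> L @ [(k, l)] \<approx> merges \<alpha>' (l # L)"
proof (induction L)
  case Nil
  then show ?case using kl \<alpha>' by simp
next
  case (Cons x L)
  have x: "x \<in> I" "\<alpha> x \<in> I" "\<alpha> x \<noteq> x" "x \<noteq> k" "x \<noteq> l"
    using Cons.prems \<alpha> kl by (auto simp: retraction_def)
  have swap: "[(\<alpha> x, x), (k, l)] \<approx> [(k, l), (\<alpha>' x, x)]"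
  proof -
    consider "\<alpha> x = l" | "\<alpha> x = k" | "\<alpha> x \<noteq> l" "\<alpha> x \<noteq> k" by blast
    then show ?thesis
    proof cases
      case 1
      have "[(k, l), (k, x)] \<approx> [(l, x), (k, l)]"
        by (rule redirect) (use kl x in auto)
      then show ?thesis using 1 \<alpha>' by (simp add: weq_sym)
    next
      case 2
      have "[(k, x), (k, l)] \<approx> [(k, l), (k, x)]"
        by (rule srel_weq, rule s4a) (use kl x in auto)
      then show ?thesis using 2 kl \<alpha>' by simp
    next
      case 3
      have "[(\<alpha> x, x), (k, l)] \<approx> [(k, l), (\<alpha> x, x)]"
        by (rule disjoint_commute) (use kl x 3 in auto)
      then show ?thesis using 3 \<alpha>' by simp
    qed
  qed
  have "merges \<alpha> (x # L) @ [(k, l)] \<approx> [(\<alpha> x, x)] @ merges \<alpha>' (l # L)"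
    using weq_prefix[of "merges \<alpha> L @ [(k, l)]" "merges \<alpha>' (l # L)" "[(\<alpha> x, x)]"] Cons by simp
  also have "\<dots> = [(\<alpha> x, x), (k, l)] @ merges \<alpha>' L"
    using kl \<alpha>' by simp
  also have "\<dots> \<approx> [(k, l), (\<alpha>' x, x)] @ merges \<alpha>' L"
    by (rule weq_suffix[OF swap])
  finally show ?case using kl \<alpha>' by simp
qed

text \<open>The condition \<open>\<alpha> x \<le> x\<close> makes \<open>\<alpha>\<close> choose the
  least point of each class, so it depends only on the kernel of the map. The word \<open>u\<close>
  moves the remaining tokens without identifying any.\<close>

definition normal_form :: "(nat \<Rightarrow> nat) \<Rightarrow> nat list \<Rightarrow> (nat \<times> nat) list \<Rightarrow> bool" where
  "normal_form \<alpha> L u \<longleftrightarrow> retraction \<alpha> \<and> (\<forall>x \<in> I. \<alpha> x \<le> x) \<and> distinct L \<and>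
    set L = {x \<in> I. \<alpha> x \<noteq> x} \<and> u \<in> lists (letters I) \<and> inj_on (act u) (\<alpha> ` I)"

text \<open>The merge is pulled in front of \<open>u\<close>, directed to the smaller of the two
  points and absorbed into the merge word.\<close>

lemma normal_form_merge:
  assumes nf: "normal_form \<alpha> L u"
    and ij: "i \<in> img (merges \<alpha> L @ u)" "j \<in> img (merges \<alpha> L @ u)" "i \<noteq> j"
  shows "\<exists>\<alpha>' L' u'. normal_form \<alpha>' L' u' \<and> merges \<alpha> L @ u @ [(i, j)] \<approx> merges \<alpha>' L' @ u'"
proof -
  define m where "m = merges \<alpha> L"
  have \<alpha>: "retraction \<alpha>" "\<And>x. x \<in> I \<Longrightarrow> \<alpha> x \<le> x" and L: "distinct L" "set L = {x \<in> I. \<alpha> x \<noteq> x}"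
    and u: "u \<in> lists (letters I)" and inj: "inj_on (act u) (\<alpha> ` I)"
    using nf by (auto simp: normal_form_def)
  have m: "m \<in> lists (letters I)"
    using merges_letters[OF \<alpha>(1)] L by (simp add: m_def)
  have img_m: "img m = \<alpha> ` I"
    using img_merges \<alpha>(1) L by (simp add: m_def)
  have fixed: "\<alpha> x = x" "x \<in> I" if "x \<in> img m" for x
    using that \<alpha>(1) by (auto simp: img_m retraction_def)
  have "\<exists>k \<in> img m. \<exists>l \<in> img m. \<exists>u' \<in> lists (letters I). k < l \<and> m @ u @ [(i, j)] \<approx> m @ (k, l) # u'"
  proof -
    obtain k l u' where u': "k \<in> img m" "l \<in> img m" "u' \<in> lists (letters I)" "k \<noteq> l"
        "m @ u @ [(i, j)] \<approx> m @ (k, l) # u'"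
      using merge_before_moves[OF m u, of i j] inj ij by (auto simp: img_m m_def[symmetric])
    show ?thesis
    proof (cases "k < l")
      case True
      then show ?thesis using u' by blast
    next
      case False
      \<comment> \<open>R1 merges into the smaller point \<open>l\<close> instead; the letter
        \<open>(k, l)\<close> then brings the merged token back to \<open>k\<close> and is counted
        among the later moves.\<close>
      have "[(k, l)] \<approx> [(l, k), (k, l)]"
        by (rule srel_weq, rule s1b) (use u' fixed in auto)
      from weq_append[OF this, of m u']
      have "m @ u @ [(i, j)] \<approx> m @ (l, k) # ((k, l) # u')"
        using u'(5) by (auto intro: weq_trans)
      moreover have "(k, l) # u' \<in> lists (letters I)" using u' fixed by auto
      ultimately show ?thesis using u' False by (meson linorder_neqE_nat)
    qed
  qed
  then obtain k l u' where kl: "k \<in> img m" "l \<in> img m" "k < l" and u': "u' \<in> lists (letters I)"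
    and eq: "m @ u @ [(i, j)] \<approx> m @ (k, l) # u'"
    by blast
  define \<alpha>' where "\<alpha>' = (\<lambda>x. if \<alpha> x = l then k else \<alpha> x)"
  have \<alpha>'_ret: "retraction \<alpha>'"
    using \<alpha>(1) fixed[OF kl(1)] fixed[OF kl(2)] by (auto simp: retraction_def \<alpha>'_def)
  have \<alpha>'_le: "\<alpha>' x \<le> x" if "x \<in> I" for x
    using \<alpha>(2)[OF that] kl(3) by (auto simp: \<alpha>'_def)
  have L': "distinct (l # L)" "set (l # L) = {x \<in> I. \<alpha>' x \<noteq> x}"
  proof -
    have "\<alpha>' x \<noteq> x \<longleftrightarrow> x = l \<or> \<alpha> x \<noteq> x" for x
      using fixed(1)[OF kl(1)] fixed(1)[OF kl(2)] kl(3) unfolding \<alpha>'_def by (metis less_irrefl)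
    then show "set (l # L) = {x \<in> I. \<alpha>' x \<noteq> x}"
      using L(2) fixed(2)[OF kl(2)] by auto
    show "distinct (l # L)"
      using L fixed(1)[OF kl(2)] by simp
  qed
  have merged: "m @ [(k, l)] \<approx> merges \<alpha>' (l # L)"
    unfolding m_def
    by (rule merges_snoc[OF \<alpha>(1) fixed(2)[OF kl(1)] fixed(2)[OF kl(2)] less_imp_neq[OF kl(3)]
          fixed(1)[OF kl(1)] fixed(1)[OF kl(2)] \<alpha>'_def])
      (simp add: L(2))
  have "m @ (k, l) # u' \<approx> merges \<alpha>' (l # L) @ u'"
    using weq_suffix[OF merged, of u'] by simp
  with eq have eq': "m @ u @ [(i, j)] \<approx> merges \<alpha>' (l # L) @ u'"
    by (rule weq_trans)
  have ij': "i \<in> img (m @ u)" "j \<in> img (m @ u)"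
    using ij by (simp_all add: m_def)
  \<comment> \<open>Counting: the appended merge loses exactly one image point, and so does passing
    from \<open>\<alpha>\<close> to \<open>\<alpha>'\<close>. Since \<open>u\<close> loses none,
    neither does \<open>u'\<close>.\<close>
  have "inj_on (act u') (img (merges \<alpha>' (l # L)))"
  proof (rule eq_card_imp_inj_on)
    have "act u' ` img (merges \<alpha>' (l # L)) = img ((m @ u) @ [(i, j)])"
      using weq_img[OF eq'] by (simp only: img_append append.assoc)
    also have "\<dots> = insert i (img (m @ u) - {j})"
      using img_snoc[OF ij(3), of "m @ u"] ij' by simp
    also have "\<dots> = img (m @ u) - {j}"
      using ij' ij(3) by auto
    finally have "card (act u' ` img (merges \<alpha>' (l # L))) = card (img (m @ u)) - 1"
      using ij' by simp
    also have "card (img (m @ u)) = card (img m)"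
      using inj by (simp add: img_append card_image img_m)
    also have "card (img m) - 1 = card (img m - {l})"
      using kl by simp
    also have "img m - {l} = insert k (img m - {l})"
      using kl by auto
    also have "\<dots> = img (merges \<alpha>' (l # L))"
      using img_snoc[OF less_imp_neq[OF kl(3)], of m] kl(2) weq_img[OF merged] by (simp only: if_True)
    finally show "card (act u' ` img (merges \<alpha>' (l # L))) = card (img (merges \<alpha>' (l # L)))" .
  qed simp
  then have "normal_form \<alpha>' (l # L) u'"
    using \<alpha>'_ret \<alpha>'_le L' u' img_merges[OF \<alpha>'_ret L'(2)] by (simp add: normal_form_def)
  then show ?thesis using eq' unfolding m_def by blast
qed

text \<open>Letter by letter: an idle letter disappears, a slide extends \<open>u\<close>, and a
  merge is handled by \<open>normal_form_merge\<close>.\<close>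

lemma normal_form_exists:
  "w \<in> lists (letters I) \<Longrightarrow> \<exists>\<alpha> L u. normal_form \<alpha> L u \<and> w \<approx> merges \<alpha> L @ u"
proof (induction w rule: rev_induct)
  case Nil
  have "normal_form id [] []"
    by (simp add: normal_form_def retraction_def inj_on_def)
  then show ?case by (metis append_Nil merges_simps(1) weq_refl)
next
  case (snoc x w)
  obtain i j where x: "x = (i, j)" by force
  have w: "w \<in> lists (letters I)" and ij: "i \<in> I" "j \<in> I" "i \<noteq> j"
    using snoc.prems x by auto
  from snoc.IH[OF w] obtain \<alpha> L u where nf: "normal_form \<alpha> L u" and eq: "w \<approx> merges \<alpha> L @ u"
    by blast
  define v where "v = merges \<alpha> L @ u"
  have v: "v \<in> lists (letters I)"
    using nf merges_letters[of \<alpha> L] by (simp add: v_def normal_form_def)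
  have img_v: "img v = act u ` \<alpha> ` I"
    using nf img_merges[of \<alpha> L] by (simp add: v_def img_append normal_form_def)
  have eq': "w @ [x] \<approx> v @ [(i, j)]"
    using weq_suffix[OF eq, of "[x]"] x by (simp add: v_def)
  consider "j \<notin> img v" | "i \<notin> img v" "j \<in> img v" | "i \<in> img v" "j \<in> img v" by blast
  then show ?case
  proof cases
    case 1
    have "v @ [(i, j)] \<approx> v" by (rule idle_move) (use v ij 1 in auto)
    then show ?thesis using eq' nf unfolding v_def by (meson weq_trans)
  next
    case 2
    have "inj_on (act u) (\<alpha> ` I)" using nf by (simp add: normal_form_def)
    then have "inj_on (act (u @ [(i, j)])) (\<alpha> ` I)"
      using 2(1) unfolding inj_on_def img_v by (auto split: if_splits)
    then have "normal_form \<alpha> L (u @ [(i, j)])"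
      using nf ij by (simp add: normal_form_def)
    then show ?thesis using eq' unfolding v_def by (metis append.assoc)
  next
    case 3
    with normal_form_merge[OF nf] ij obtain \<alpha>' L' u'
      where "normal_form \<alpha>' L' u'" "v @ [(i, j)] \<approx> merges \<alpha>' L' @ u'"
      unfolding v_def by (metis append.assoc)
    then show ?thesis using eq' by (meson weq_trans)
  qed
qed

section \<open>Uniqueness of normal forms and completeness of the undecorated relations\<close>

lemma normal_form_act:
  assumes "normal_form \<alpha> L u" "w \<approx> merges \<alpha> L @ u" "x \<in> I"
  shows "act w x = act u (\<alpha> x)"
proof -
  have "act w x = act u (act (merges \<alpha> L) x)"
    using weq_act[OF assms(2)] by simp
  then show ?thesis
    using act_merges[of \<alpha> L x] assms(1,3) by (simp add: normal_form_def)
qed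

text \<open>The point \<open>\<beta> x\<close> lies in the class of \<open>x\<close>, so
  \<open>\<alpha> (\<beta> x) = \<alpha> x\<close> by injectivity of \<open>u\<close>, and
  \<open>\<alpha>\<close> does not increase \<open>\<beta> x\<close>. By symmetry the two
  retractions agree on \<open>I\<close>.\<close>

lemma normal_form_retract_le:
  assumes nf: "normal_form \<alpha> L u" "w \<approx> merges \<alpha> L @ u" "normal_form \<beta> K v" "w' \<approx> merges \<beta> K @ v"
    and eq: "\<And>x. x \<in> I \<Longrightarrow> act w x = act w' x" and x: "x \<in> I"
  shows "\<alpha> x \<le> \<beta> x"
proof -
  have \<beta>x: "\<beta> x \<in> I" "\<beta> (\<beta> x) = \<beta> x"
    using nf(3) x by (auto simp: normal_form_def retraction_def)
  have "act w (\<beta> x) = act w' x"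
    using normal_form_act[OF nf(3,4)] eq \<beta>x x by simp
  then have "act u (\<alpha> (\<beta> x)) = act u (\<alpha> x)"
    using normal_form_act[OF nf(1,2)] eq \<beta>x x by simp
  then have "\<alpha> (\<beta> x) = \<alpha> x"
    using nf(1) x \<beta>x by (auto simp: normal_form_def dest: inj_onD)
  then show ?thesis
    using nf(1) \<beta>x by (metis normal_form_def)
qed

text \<open>Normal forms of the same map have the same retraction, so their merge words are
  permutations of each other, and the remaining moves agree by \<open>moves_unique\<close>.\<close>

lemma weq_complete:
  assumes w: "w \<in> lists (letters I)" "w' \<in> lists (letters I)"
    and eq: "\<And>x. x \<in> I \<Longrightarrow> act w x = act w' x"
  shows "w \<approx> w'"
proof -
  obtain \<alpha> L u where nf: "normal_form \<alpha> L u" "w \<approx> merges \<alpha> L @ u"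
    using normal_form_exists[OF w(1)] by blast
  obtain \<beta> K v where nf': "normal_form \<beta> K v" "w' \<approx> merges \<beta> K @ v"
    using normal_form_exists[OF w(2)] by blast
  have \<alpha>\<beta>: "\<alpha> x = \<beta> x" if "x \<in> I" for x
    using normal_form_retract_le[OF nf nf' eq that] normal_form_retract_le[OF nf' nf _ that] eq
    by (simp add: order_antisym)
  have \<alpha>: "retraction \<alpha>" and L: "set L = {x \<in> I. \<alpha> x \<noteq> x}" "distinct L" and K: "distinct K" "set K = set L"
    and u: "u \<in> lists (letters I)" "v \<in> lists (letters I)" "inj_on (act u) (\<alpha> ` I)"
    using nf(1) nf'(1) \<alpha>\<beta> by (auto simp: normal_form_def)
  have "merges \<beta> K = merges \<alpha> K"
    using K L \<alpha>\<beta> by (simp add: merges_def)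
  moreover have "merges \<alpha> L \<approx> merges \<alpha> K"
    by (rule merges_permute[OF \<alpha>]) (use L K in auto)
  ultimately have w': "w' \<approx> merges \<alpha> L @ v"
    using nf'(2) weq_suffix[of "merges \<alpha> L" "merges \<alpha> K" v] by (metis weq_sym weq_trans)
  have "merges \<alpha> L @ u \<approx> merges \<alpha> L @ v"
  proof (rule moves_unique)
    show "merges \<alpha> L \<in> lists (letters I)" using merges_letters[OF \<alpha>] L by simp
    show "inj_on (act u) (img (merges \<alpha> L))" using u(3) img_merges[OF \<alpha> L(1)] by simp
    show "act u x = act v x" if x: "x \<in> img (merges \<alpha> L)" for x
    proof -
      obtain y where "y \<in> I" "x = \<alpha> y" using x img_merges[OF \<alpha> L(1)] by auto
      then show ?thesis
        using normal_form_act[OF nf] normal_form_act[OF nf'] \<alpha>\<beta> eq by simp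
    qed
  qed (use u in auto)
  then show ?thesis using nf(2) w' by (meson weq_sym weq_trans)
qed

section \<open>Singular maps as words\<close>

text \<open>Induction on the number of misplaced tokens: one more token is put in place, without
  disturbing those already placed and without identifying tokens that \<open>\<beta>\<close>
  separates.\<close>

lemma reach_coarser_map:
  assumes \<beta>: "\<beta> \<in> I \<rightarrow> I"
  shows "w \<in> lists (letters I) \<Longrightarrow> \<not> inj_on (act w) I \<Longrightarrow>
    (\<And>x y. x \<in> I \<Longrightarrow> y \<in> I \<Longrightarrow> act w x = act w y \<Longrightarrow> \<beta> x = \<beta> y) \<Longrightarrow>
    \<exists>u \<in> lists (letters I). \<forall>x \<in> I. act (w @ u) x = \<beta> x"
proof (induction "card {x \<in> I. act w x \<noteq> \<beta> x}" arbitrary: w rule: less_induct)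
  case less
  show ?case
  proof (cases "\<forall>x \<in> I. act w x = \<beta> x")
    case True
    then show ?thesis by (intro bexI[of _ "[]"]) auto
  next
    case False
    then obtain x where x: "x \<in> I" "act w x \<noteq> \<beta> x" by blast
    have wI: "act w y \<in> I" if "y \<in> I" for y
      using act_in[OF less.prems(1) that] .
    have step: ?thesis
      if c: "c \<in> lists (letters I)" and cx: "act c (act w x) = \<beta> x"
        and ker: "\<And>y z. y \<in> I \<Longrightarrow> z \<in> I \<Longrightarrow> act c (act w y) = act c (act w z) \<Longrightarrow> \<beta> y = \<beta> z"
        and keep: "\<And>y. y \<in> I \<Longrightarrow> act w y = \<beta> y \<Longrightarrow> act c (act w y) = \<beta> y" for c
    proof -
      have "{y \<in> I. act (w @ c) y \<noteq> \<beta> y} \<subset> {y \<in> I. act w y \<noteq> \<beta> y}"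
        using x cx keep by auto
      then have "card {y \<in> I. act (w @ c) y \<noteq> \<beta> y} < card {y \<in> I. act w y \<noteq> \<beta> y}"
        using finite_I by (intro psubset_card_mono) auto
      moreover have "\<not> inj_on (act (w @ c)) I"
      proof
        assume inj: "inj_on (act (w @ c)) I"
        have "inj_on (act w) I"
          by (rule inj_onI, rule inj_onD[OF inj]) auto
        with less.prems(2) show False ..
      qed
      moreover have "w @ c \<in> lists (letters I)" using less.prems(1) c by simp
      moreover have "\<beta> y = \<beta> z" if "y \<in> I" "z \<in> I" "act (w @ c) y = act (w @ c) z" for y z
        using ker[OF that(1,2)] that(3) by simp
      ultimately have "\<exists>u \<in> lists (letters I). \<forall>y \<in> I. act ((w @ c) @ u) y = \<beta> y"
        by (intro less.hyps)
      then obtain u where "u \<in> lists (letters I)" "\<forall>y \<in> I. act ((w @ c) @ u) y = \<beta> y"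
        by blast
      then show ?thesis using c by (intro bexI[of _ "c @ u"]) auto
    qed
    have \<beta>I: "\<beta> x \<in> I" using \<beta> x(1) by auto
    have at_x: "\<beta> z = \<beta> x" if "z \<in> I" "act w z = act w x" for z
      using less.prems(3)[OF that(1) x(1)] that(2) by simp
    show ?thesis
    proof (cases "\<exists>y \<in> I. act w y = \<beta> x \<and> \<beta> y \<noteq> \<beta> x")
      case False
      then have at_bx: "\<beta> z = \<beta> x" if "z \<in> I" "act w z = \<beta> x" for z
        using that by blast
      have move: "act [(\<beta> x, act w x)] (act w z) = (if act w z = act w x then \<beta> x else act w z)" for z
        by simp
      \<comment> \<open>Every token at \<open>\<beta> x\<close> belongs there, as do those at
        \<open>act w x\<close>, so the direct move may merge them.\<close>
      show ?thesis
      proof (rule step[of "[(\<beta> x, act w x)]"])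
        fix z z' assume zz: "z \<in> I" "z' \<in> I"
          "act [(\<beta> x, act w x)] (act w z) = act [(\<beta> x, act w x)] (act w z')"
        show "\<beta> z = \<beta> z'"
          using zz(3) at_bx[OF zz(1)] at_bx[OF zz(2)] at_x[OF zz(1)] at_x[OF zz(2)] less.prems(3)[OF zz(1,2)]
          unfolding move by (simp split: if_splits)
      next
        fix z assume z: "z \<in> I" "act w z = \<beta> z"
        show "act [(\<beta> x, act w x)] (act w z) = \<beta> z"
          using z(2) at_x[OF z(1)] x unfolding move by auto
      qed (use x \<beta>I wI in auto)
    next
      case True
      then obtain y where y: "y \<in> I" "act w y = \<beta> x" "\<beta> y \<noteq> \<beta> x" by blast
      \<comment> \<open>A noninjective map of a finite set leaves a hole \<open>h\<close>. The
        tokens at \<open>\<beta> x\<close>, which belong elsewhere, are parked there first.\<close>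
      have "img w \<noteq> I"
        using less.prems(2) finite_I eq_card_imp_inj_on by (metis img_def)
      then obtain h where h: "h \<in> I" "h \<notin> img w"
        using img_subset[OF less.prems(1)] by blast
      have hw: "act w z \<noteq> h" if "z \<in> I" for z
        using h(2) that by (auto simp: img_def)
      have hb: "h \<noteq> \<beta> x" using hw[OF y(1)] y(2) by simp
      have at_bx: "\<beta> z = \<beta> y" if "z \<in> I" "act w z = \<beta> x" for z
        using less.prems(3)[OF that(1) y(1)] that(2) y(2) by simp
      have move: "act [(h, \<beta> x), (\<beta> x, act w x)] (act w z) =
          (if act w z = \<beta> x then h else if act w z = act w x then \<beta> x else act w z)" if "z \<in> I" for z
        using hw[OF x(1)] x(2) by auto
      show ?thesis
      proof (rule step[of "[(h, \<beta> x), (\<beta> x, act w x)]"])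
        fix z z' assume zz: "z \<in> I" "z' \<in> I"
          "act [(h, \<beta> x), (\<beta> x, act w x)] (act w z) = act [(h, \<beta> x), (\<beta> x, act w x)] (act w z')"
        show "\<beta> z = \<beta> z'"
          using zz(3) hw[OF zz(1)] hw[OF zz(2)] hb at_bx[OF zz(1)] at_bx[OF zz(2)]
            at_x[OF zz(1)] at_x[OF zz(2)] less.prems(3)[OF zz(1,2)] y(3)
          unfolding move[OF zz(1)] move[OF zz(2)] by (auto split: if_splits)
      next
        fix z assume z: "z \<in> I" "act w z = \<beta> z"
        show "act [(h, \<beta> x), (\<beta> x, act w x)] (act w z) = \<beta> z"
          using z(2) at_bx[OF z(1)] at_x[OF z(1)] y x unfolding move[OF z(1)] by auto
      qed (use x h hb \<beta>I wI hw in auto)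
    qed
  qed
qed

lemma singular_map_is_word:
  assumes \<beta>: "\<beta> \<in> I \<rightarrow> I" "\<not> inj_on \<beta> I"
  shows "\<exists>w \<in> lists (letters I). w \<noteq> [] \<and> (\<forall>x \<in> I. act w x = \<beta> x)"
proof -
  obtain i j where ij: "i \<in> I" "j \<in> I" "i \<noteq> j" "\<beta> i = \<beta> j"
    using \<beta>(2) unfolding inj_on_def by blast
  \<comment> \<open>A single merge is a valid start: it is not injective and identifies only
    \<open>i\<close> and \<open>j\<close>, which \<open>\<beta>\<close> identifies too.\<close>
  have "\<exists>u \<in> lists (letters I). \<forall>x \<in> I. act ([(i, j)] @ u) x = \<beta> x"
  proof (rule reach_coarser_map[OF \<beta>(1)])
    show "\<not> inj_on (act [(i, j)]) I"
      using inj_onD[of "act [(i, j)]" I i j] ij by auto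
  qed (use ij in \<open>auto split: if_splits\<close>)
  then obtain u where "u \<in> lists (letters I)" "\<forall>x \<in> I. act ([(i, j)] @ u) x = \<beta> x"
    by blast
  then show ?thesis using ij by (intro bexI[of _ "[(i, j)] @ u"]) auto
qed

end

section \<open>Decorated words and the wreath product\<close>

lemma free_ext_Cons: "w \<noteq> [] \<Longrightarrow> free_ext T f (x # w) = f x \<odot>\<^bsub>T\<^esub> free_ext T f w"
  by (cases w) simp_all

lemma (in semigrp) free_ext_hom:
  assumes f: "f \<in> X \<rightarrow> carrier S"
  shows "free_ext S f \<in> semigrp_hom (free_semigrp X) S"
proof -
  have closed: "free_ext S f u \<in> carrier S" if "u \<noteq> []" "set u \<subseteq> X" for u
    using that
  proof (induction u rule: list_nonempty_induct)
    case (single x)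
    then show ?case using f by auto
  next
    case (cons x xs)
    then show ?case using f by (auto simp: free_ext_Cons intro: smult_closed)
  qed
  moreover have "free_ext S f (u @ v) = free_ext S f u \<odot> free_ext S f v"
    if "u \<noteq> []" "set u \<subseteq> X" "v \<noteq> []" "set v \<subseteq> X" for u v
    using that(1,2)
  proof (induction u rule: list_nonempty_induct)
    case (single x)
    then show ?case using that(3) by (simp add: free_ext_Cons)
  next
    case (cons x xs)
    moreover have "f x \<in> carrier S" using cons.prems f by auto
    ultimately show ?case
      using that(3,4) closed by (simp add: free_ext_Cons smult_assoc)
  qed
  ultimately show ?thesis by (simp add: semigrp_hom_def free_semigrp_def)
qed

lemma kernel_congruence:
  assumes T: "semigrp S" and h: "h \<in> semigrp_hom S T"
  shows "semigrp_congruence S {(u, v). u \<in> carrier S \<and> v \<in> carrier S \<and> h u = h v}"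
  using h semigrp.smult_closed[OF T]
  by (auto simp: semigrp_congruence_def semigrp_hom_def equiv_def refl_on_def sym_on_def trans_on_def)

lemma semigrp_free: "semigrp (free_semigrp X)"
  by unfold_locales (auto simp: free_semigrp_def)

text \<open>Compatibility is available only for factors in the free semigroup, so empty contexts are
  separate cases.\<close>

lemma congruence_context:
  assumes "semigrp_congruence (free_semigrp X) \<rho>" "(u, v) \<in> \<rho>" "set p \<subseteq> X" "set q \<subseteq> X"
  shows "(p @ u @ q, p @ v @ q) \<in> \<rho>"
proof -
  have l: "(p @ u, p @ v) \<in> \<rho>"
    using assms by (cases "p = []") (auto simp: semigrp_congruence_def free_semigrp_def)
  have "((p @ u) @ q, (p @ v) @ q) \<in> \<rho>"
  proof (cases "q = []")
    case False
    then have "q \<in> carrier (free_semigrp X)" using assms(4) by (simp add: free_semigrp_def)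
    with l assms(1) have "((p @ u) \<odot>\<^bsub>free_semigrp X\<^esub> q, (p @ v) \<odot>\<^bsub>free_semigrp X\<^esub> q) \<in> \<rho>"
      unfolding semigrp_congruence_def by blast
    then show ?thesis by (simp add: free_semigrp_def)
  qed (use l in simp)
  then show ?thesis by simp
qed

fun index :: "'a letter \<Rightarrow> nat \<times> nat" where
  "index (E i j a) = (i, j)"

locale wreath = monoid M for M :: "('a, 'c) monoid_scheme" (structure) +
  fixes n :: nat
begin

sublocale positions "{1..n}"
  by unfold_locales simp

declare One_nat_def [simp del]

abbreviation unit_word :: "(nat \<times> nat) list \<Rightarrow> 'a letter list" where
  "unit_word w \<equiv> map (\<lambda>(i, j). E1 M n i j) w"

text \<open>\<open>R7\<close> concentrates all tuples of a word in its first letter.\<close>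
fun decorate :: "(nat \<Rightarrow> 'a) \<Rightarrow> (nat \<times> nat) list \<Rightarrow> 'a letter list" where
  "decorate a [] = []"
| "decorate a ((i, j) # w) = E i j a # unit_word w"

lemma decorate_append: "u \<noteq> [] \<Longrightarrow> decorate a (u @ v) = decorate a u @ unit_word v"
  by (cases u) auto

lemma decorate_one: "decorate (one_tuple M n) w = unit_word w"
  by (cases w) auto

lemma one_tuple_in [simp]: "one_tuple M n \<in> tuples M n"
  by (auto simp: one_tuple_def tuples_def)

lemma tuples_mem: "a \<in> tuples M n \<Longrightarrow> k \<in> {1..n} \<Longrightarrow> a k \<in> carrier M"
  unfolding tuples_def by (rule PiE_mem)

lemma restrict_in_tuples:
  "restrict f {1..n} \<in> tuples M n \<longleftrightarrow> (\<forall>k \<in> {1..n}. f k \<in> carrier M)"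
  by (simp add: tuples_def restrict_PiE_iff Pi_iff)

lemma unit_word_in: "w \<in> lists (letters {1..n}) \<Longrightarrow> set (unit_word w) \<subseteq> alphabet M n"
  by (auto simp: alphabet_def letters_def)

lemma decorate_in:
  "a \<in> tuples M n \<Longrightarrow> w \<in> lists (letters {1..n}) \<Longrightarrow> set (decorate a w) \<subseteq> alphabet M n"
proof (cases w)
  case (Cons x w')
  assume a: "a \<in> tuples M n" and w: "w \<in> lists (letters {1..n})"
  obtain i j where x: "x = (i, j)" by force
  have "E i j a \<in> alphabet M n"
    using a w Cons x by (simp add: alphabet_def)
  then show ?thesis
    using unit_word_in[of w'] w Cons x by simp
qed simp

lemma decorate_eq_Nil [simp]: "decorate a w = [] \<longleftrightarrow> w = []"
  by (cases w) auto

text \<open>The tuple of R7, which is also the tuple of a product of \<open>(a, eps n i j)\<close>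
  with any element whose tuple is \<open>b\<close>, see \<open>fst_phi_Cons\<close>.\<close>

definition join :: "(nat \<Rightarrow> 'a) \<Rightarrow> nat \<Rightarrow> nat \<Rightarrow> (nat \<Rightarrow> 'a) \<Rightarrow> nat \<Rightarrow> 'a" where
  "join a i j b = (\<lambda>r \<in> {1..n}. if r = j then a j \<otimes> b i else a r \<otimes> b r)"

lemma join_in: "a \<in> tuples M n \<Longrightarrow> b \<in> tuples M n \<Longrightarrow> i \<in> {1..n} \<Longrightarrow> join a i j b \<in> tuples M n"
  by (simp add: join_def restrict_in_tuples tuples_mem)

text \<open>Lets R1 to R6 be treated uniformly, as decorations of undecorated relations, with R7 as
  the only other case.\<close>

lemma rels_eq:
  "rels M n = {(decorate a u, decorate a v) | a u v. a \<in> tuples M n \<and> srel u v} \<union>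
    {([E i j a, E k l b], [E i j (join a i j b), E1 M n k l]) | i j k l a b.
      a \<in> tuples M n \<and> b \<in> tuples M n \<and> {i, j, k, l} \<subseteq> {1..n} \<and> i \<noteq> j \<and> k \<noteq> l}"
  (is "_ = ?A \<union> ?B")
proof
  have A: "(x, y) \<in> ?A" if "srel u v" "a \<in> tuples M n" "x = decorate a u" "y = decorate a v" for a u v x y
    using that by blast
  show "rels M n \<subseteq> ?A \<union> ?B"
  proof (rule subrelI)
    fix x y assume "(x, y) \<in> rels M n"
    then show "(x, y) \<in> ?A \<union> ?B"
    proof cases
      case (R1a a i j)
      show ?thesis
        by (rule UnI1, rule A[OF s1a[of i j] R1a(3)]) (use R1a in simp_all)
    next
      case (R1b a i j)
      show ?thesis
        by (rule UnI1, rule A[OF s1b[of i j] R1b(3)]) (use R1b in simp_all)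
    next
      case (R2 a i j k l)
      show ?thesis
        by (rule UnI1, rule A[OF s2[of i j k l] R2(3)]) (use R2 in simp_all)
    next
      case (R3 a i j k)
      show ?thesis
        by (rule UnI1, rule A[OF s3[of i j k] R3(3)]) (use R3 in simp_all)
    next
      case (R4a a i j k)
      show ?thesis
        by (rule UnI1, rule A[OF s4a[of i j k] R4a(3)]) (use R4a in simp_all)
    next
      case (R4b a i j k)
      show ?thesis
        by (rule UnI1, rule A[OF s4b[of i j k] R4b(3)]) (use R4b in simp_all)
    next
      case (R5 a i j k)
      show ?thesis
        by (rule UnI1, rule A[OF s5[of i j k] R5(3)]) (use R5 in simp_all)
    next
      case (R6 a i j k l)
      show ?thesis
        by (rule UnI1, rule A[OF s6[of i j k l] R6(3)]) (use R6 in simp_all)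
    next
      case (R7 a b i j k l)
      then have "(x, y) \<in> ?B" unfolding join_def by blast
      then show ?thesis ..
    qed
  qed
  have "(decorate a u, decorate a v) \<in> rels M n" if "srel u v" "a \<in> tuples M n" for a u v
    using that by cases (simp_all add: rels.intros)
  moreover have "?B \<subseteq> rels M n"
    unfolding join_def by (auto intro!: rels.R7)
  ultimately show "?A \<union> ?B \<subseteq> rels M n"
    by (intro Un_least) auto
qed

section \<open>The wreath product and the map \<open>phi\<close>\<close>

lemma wreath_carrier [simp]: "carrier (wreath_sing M n) = tuples M n \<times> sing n"
  by (simp add: wreath_sing_def)

lemma wreath_smult [simp]:
  "(a, \<alpha>) \<odot>\<^bsub>wreath_sing M n\<^esub> (b, \<beta>) =
    (\<lambda>k \<in> {1..n}. a k \<otimes> b (\<alpha> k), compose {1..n} \<beta> \<alpha>)"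
  by (simp add: wreath_sing_def)

lemma sing_iff: "\<alpha> \<in> sing n \<longleftrightarrow> \<alpha> \<in> {1..n} \<rightarrow>\<^sub>E {1..n} \<and> \<not> inj_on \<alpha> {1..n}"
proof -
  have "bij_betw \<alpha> {1..n} {1..n} \<longleftrightarrow> inj_on \<alpha> {1..n}" if "\<alpha> \<in> {1..n} \<rightarrow>\<^sub>E {1..n}"
    using that endo_inj_surj[of "{1..n}" \<alpha>] by (auto simp: bij_betw_def PiE_def)
  then show ?thesis by (auto simp: sing_def)
qed

lemma eps_sing:
  assumes "i \<in> {1..n}" "j \<in> {1..n}" "i \<noteq> j"
  shows "eps n i j \<in> sing n"
proof -
  have "\<not> inj_on (eps n i j) {1..n}"
    using inj_onD[of "eps n i j" "{1..n}" i j] assms by (auto simp: eps_def)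
  then show ?thesis using assms by (auto simp: sing_iff eps_def)
qed

lemma semigrp_wreath: "semigrp (wreath_sing M n)"
proof
  fix x y assume "x \<in> carrier (wreath_sing M n)" "y \<in> carrier (wreath_sing M n)"
  then obtain a \<alpha> b \<beta> where xy: "x = (a, \<alpha>)" "y = (b, \<beta>)" "a \<in> tuples M n" "b \<in> tuples M n"
      "\<alpha> \<in> sing n" "\<beta> \<in> sing n"
    by auto
  have mem: "\<alpha> k \<in> {1..n}" "\<beta> k \<in> {1..n}" if "k \<in> {1..n}" for k
    using xy that unfolding sing_iff by (blast intro: PiE_mem)+
  obtain k l where kl: "k \<in> {1..n}" "l \<in> {1..n}" "k \<noteq> l" "\<alpha> k = \<alpha> l"
    using xy unfolding sing_iff inj_on_def by blast
  then have "\<not> inj_on (compose {1..n} \<beta> \<alpha>) {1..n}"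
    using inj_onD[of "compose {1..n} \<beta> \<alpha>" "{1..n}" k l] by (auto simp: compose_eq)
  then have "compose {1..n} \<beta> \<alpha> \<in> sing n"
    using mem by (simp add: sing_iff compose_def restrict_PiE_iff)
  moreover have "(\<lambda>k \<in> {1..n}. a k \<otimes> b (\<alpha> k)) \<in> tuples M n"
    unfolding restrict_in_tuples using xy mem tuples_mem by blast
  ultimately show "x \<odot>\<^bsub>wreath_sing M n\<^esub> y \<in> carrier (wreath_sing M n)"
    by (simp add: xy)
next
  fix x y z
  assume "x \<in> carrier (wreath_sing M n)" "y \<in> carrier (wreath_sing M n)" "z \<in> carrier (wreath_sing M n)"
  then obtain a \<alpha> b \<beta> c \<gamma> where xyz: "x = (a, \<alpha>)" "y = (b, \<beta>)" "z = (c, \<gamma>)"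
      "a \<in> tuples M n" "b \<in> tuples M n" "c \<in> tuples M n" "\<alpha> \<in> sing n" "\<beta> \<in> sing n" "\<gamma> \<in> sing n"
    by auto
  then have \<alpha>: "\<alpha> \<in> {1..n} \<rightarrow> {1..n}" and \<beta>: "\<beta> \<in> {1..n} \<rightarrow> {1..n}"
    by (simp_all add: sing_iff PiE_def)
  have "a k \<otimes> b (\<alpha> k) \<otimes> c (compose {1..n} \<beta> \<alpha> k) =
      a k \<otimes> (\<lambda>k \<in> {1..n}. b k \<otimes> c (\<beta> k)) (\<alpha> k)" if "k \<in> {1..n}" for k
    using that funcset_mem[OF \<alpha> that] funcset_mem[OF \<beta> funcset_mem[OF \<alpha> that]]
      tuples_mem[OF xyz(4)] tuples_mem[OF xyz(5)] tuples_mem[OF xyz(6)]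
    by (simp add: compose_eq m_assoc)
  then show "x \<odot>\<^bsub>wreath_sing M n\<^esub> y \<odot>\<^bsub>wreath_sing M n\<^esub> z = x \<odot>\<^bsub>wreath_sing M n\<^esub> (y \<odot>\<^bsub>wreath_sing M n\<^esub> z)"
    using compose_assoc[OF \<alpha>, of \<gamma> \<beta>] by (auto simp: xyz(1-3) intro!: restrict_ext)
qed

lemma letter_val_in: "letter_val n \<in> alphabet M n \<rightarrow> carrier (wreath_sing M n)"
  by (auto simp: alphabet_def eps_sing)

lemma phi_hom: "phi M n \<in> semigrp_hom (free_semigrp (alphabet M n)) (wreath_sing M n)"
  unfolding phi_def by (rule semigrp.free_ext_hom[OF semigrp_wreath letter_val_in])

lemma phi_single: "phi M n [x] = letter_val n x"
  by (simp add: phi_def)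

lemma phi_Cons: "w \<noteq> [] \<Longrightarrow> phi M n (x # w) = letter_val n x \<odot>\<^bsub>wreath_sing M n\<^esub> phi M n w"
  by (simp add: phi_def free_ext_Cons)

lemma phi_in: "w \<noteq> [] \<Longrightarrow> set w \<subseteq> alphabet M n \<Longrightarrow> phi M n w \<in> tuples M n \<times> sing n"
  using phi_hom by (auto simp: semigrp_hom_def free_semigrp_def)

lemma index_in: "set w \<subseteq> alphabet M n \<Longrightarrow> map index w \<in> lists (letters {1..n})"
  by (induction w) (auto simp: alphabet_def)

lemma snd_phi:
  "w \<noteq> [] \<Longrightarrow> set w \<subseteq> alphabet M n \<Longrightarrow> snd (phi M n w) = restrict (act (map index w)) {1..n}"
proof (induction w rule: list_nonempty_induct)
  case (single x)
  then show ?case by (auto simp: phi_single alphabet_def eps_def)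
next
  case (cons x w)
  obtain i j a where x: "x = E i j a" "i \<in> {1..n}" using cons.prems by (auto simp: alphabet_def)
  obtain c \<gamma> where phi: "phi M n w = (c, \<gamma>)" by force
  have "\<gamma> = snd (phi M n w)" by (simp add: phi)
  also have "\<dots> = restrict (act (map index w)) {1..n}"
    by (rule cons.IH) (use cons.prems in simp)
  finally have "compose {1..n} \<gamma> (eps n i j) = restrict (act (map index (x # w))) {1..n}"
    using x by (intro ext) (auto simp: compose_def eps_def)
  then show ?case
    by (simp only: phi_Cons[OF cons.hyps] phi x letter_val.simps wreath_smult snd_conv)
qed

lemma fst_phi_Cons:
  assumes "i \<in> {1..n}" "w \<noteq> []"
  shows "fst (phi M n (E i j a # w)) = join a i j (fst (phi M n w))"
proof -
  obtain c \<gamma> where phi: "phi M n w = (c, \<gamma>)" by force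
  have "fst (phi M n (E i j a # w)) = (\<lambda>k \<in> {1..n}. a k \<otimes> c (eps n i j k))"
    by (simp add: phi_Cons[OF assms(2)] phi)
  also have "\<dots> = join a i j c"
    unfolding join_def by (rule restrict_ext) (simp add: eps_def)
  finally show ?thesis by (simp add: phi)
qed

lemma join_one: "a \<in> tuples M n \<Longrightarrow> i \<in> {1..n} \<Longrightarrow> join a i j (one_tuple M n) = a"
  by (rule extensionalityI[of _ "{1..n}"]) (auto simp: join_def one_tuple_def tuples_def PiE_iff)

text \<open>All letters after the first carry the unit tuple, hence so does their product, and
  joining with it leaves \<open>a\<close> unchanged.\<close>

lemma fst_phi_decorate:
  "w \<noteq> [] \<Longrightarrow> a \<in> tuples M n \<Longrightarrow> w \<in> lists (letters {1..n}) \<Longrightarrow> fst (phi M n (decorate a w)) = a"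
proof (induction w arbitrary: a rule: list_nonempty_induct)
  case (single x)
  then show ?case by (cases x) (simp add: phi_single)
next
  case (cons x w)
  obtain i j where x: "x = (i, j)" by force
  have "fst (phi M n (unit_word w)) = one_tuple M n"
    using cons.IH[of "one_tuple M n"] cons.prems by (simp add: decorate_one)
  then show ?case
    using cons x by (simp add: fst_phi_Cons join_one)
qed

lemma index_decorate: "map index (decorate a w) = w"
proof -
  have "map index (unit_word v) = v" for v
    by (induction v) auto
  then show ?thesis by (cases w) (auto simp del: map_map)
qed

lemma phi_decorate:
  assumes "w \<noteq> []" "a \<in> tuples M n" "w \<in> lists (letters {1..n})"
  shows "phi M n (decorate a w) = (a, restrict (act w) {1..n})"
proof (rule prod_eqI)
  show "fst (phi M n (decorate a w)) = fst (a, restrict (act w) {1..n})"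
    by (simp add: fst_phi_decorate[OF assms] del: in_lists_conv_set)
  have "decorate a w \<noteq> []" using assms(1) by simp
  from snd_phi[OF this decorate_in[OF assms(2,3)]]
  show "snd (phi M n (decorate a w)) = snd (a, restrict (act w) {1..n})"
    by (simp only: index_decorate snd_conv)
qed

lemma rels_in:
  assumes "(x, y) \<in> rels M n"
  shows "x \<noteq> []" "y \<noteq> []" "set x \<subseteq> alphabet M n" "set y \<subseteq> alphabet M n"
proof -
  have "x \<noteq> [] \<and> y \<noteq> [] \<and> set x \<subseteq> alphabet M n \<and> set y \<subseteq> alphabet M n"
    using assms unfolding rels_eq
  proof
    assume "(x, y) \<in> {(decorate a u, decorate a v) | a u v. a \<in> tuples M n \<and> srel u v}"
    then obtain a u v where xy: "x = decorate a u" "y = decorate a v" "a \<in> tuples M n" "srel u v"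
      by blast
    then show ?thesis using srel_letters[OF xy(4)] decorate_in[OF xy(3)] by simp
  qed (use join_in in \<open>fastforce simp: alphabet_def\<close>)
  then show "x \<noteq> []" "y \<noteq> []" "set x \<subseteq> alphabet M n" "set y \<subseteq> alphabet M n" by auto
qed

lemma phi_R7:
  assumes ab: "a \<in> tuples M n" "b \<in> tuples M n" and ij: "i \<in> {1..n}" "j \<in> {1..n}" "i \<noteq> j"
    and kl: "k \<in> {1..n}" "l \<in> {1..n}" "k \<noteq> l"
  shows "phi M n [E i j a, E k l b] = phi M n [E i j (join a i j b), E1 M n k l]"
proof (rule prod_eqI)
  show "fst (phi M n [E i j a, E k l b]) = fst (phi M n [E i j (join a i j b), E1 M n k l])"
    using join_one[OF join_in[OF ab ij(1)] ij(1), of j] ij(1) by (simp add: fst_phi_Cons phi_single)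
  show "snd (phi M n [E i j a, E k l b]) = snd (phi M n [E i j (join a i j b), E1 M n k l])"
    using assms join_in[OF ab ij(1)] by (simp add: snd_phi alphabet_def)
qed

text \<open>Outside R7, the two sides carry the same tuple on words with the same action, so
  \<open>phi_decorate\<close> gives them equal values.\<close>

lemma rels_phi:
  assumes "(x, y) \<in> rels M n"
  shows "phi M n x = phi M n y"
  using assms unfolding rels_eq
proof
  assume "(x, y) \<in> {(decorate a u, decorate a v) | a u v. a \<in> tuples M n \<and> srel u v}"
  then obtain a u v where xy: "x = decorate a u" "y = decorate a v" "a \<in> tuples M n" "srel u v"
    by blast
  then show ?thesis using srel_letters[OF xy(4)] srel_act[OF xy(4)] by (simp add: phi_decorate)
next
  assume "(x, y) \<in> {([E i j a, E k l b], [E i j (join a i j b), E1 M n k l]) | i j k l a b.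
      a \<in> tuples M n \<and> b \<in> tuples M n \<and> {i, j, k, l} \<subseteq> {1..n} \<and> i \<noteq> j \<and> k \<noteq> l}"
  then show ?thesis
    by clarsimp (rule phi_R7, simp_all)
qed

section \<open>Every congruence containing the relations contains the kernel of
  \<open>phi\<close>\<close>

context
  fixes \<rho> :: "('a letter list \<times> 'a letter list) set"
  assumes congruence: "semigrp_congruence (free_semigrp (alphabet M n)) \<rho>"
    and rels_subset: "rels M n \<subseteq> \<rho>"
begin

lemma congruence_refl: "u \<noteq> [] \<Longrightarrow> set u \<subseteq> alphabet M n \<Longrightarrow> (u, u) \<in> \<rho>"
  using congruence by (auto simp: semigrp_congruence_def free_semigrp_def equiv_def refl_on_def)

lemma congruence_sym: "(u, v) \<in> \<rho> \<Longrightarrow> (v, u) \<in> \<rho>"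
  using congruence by (auto simp: semigrp_congruence_def equiv_def dest: symD)

lemma congruence_trans: "(u, v) \<in> \<rho> \<Longrightarrow> (v, w) \<in> \<rho> \<Longrightarrow> (u, w) \<in> \<rho>"
  using congruence by (auto simp: semigrp_congruence_def equiv_def dest: transD)

text \<open>Lifts the undecorated congruence to decorated words. Nonemptiness and the alphabet are
  carried through the induction because symmetry and transitivity need them for the other or the
  middle word.\<close>

lemma decorate_weq:
  "weq u v \<Longrightarrow> (u = [] \<longleftrightarrow> v = []) \<and> (u \<in> lists (letters {1..n}) \<longleftrightarrow> v \<in> lists (letters {1..n})) \<and>
    (u \<noteq> [] \<longrightarrow> u \<in> lists (letters {1..n}) \<longrightarrow>
      (\<forall>a \<in> tuples M n. (decorate a u, decorate a v) \<in> \<rho>))"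
proof (induction rule: weq.induct)
  case (weq_refl u)
  then show ?case
    by (intro conjI impI ballI refl congruence_refl) (simp_all add: decorate_in del: in_lists_conv_set)
next
  case (weq_sym u v)
  then show ?case using congruence_sym by blast
next
  case (weq_trans u v w)
  then show ?case using congruence_trans by blast
next
  case (weq_step u v p q)
  note uv = srel_letters[OF weq_step]
  have rel: "(decorate a u, decorate a v) \<in> \<rho>" if "a \<in> tuples M n" for a
    using rels_subset that weq_step unfolding rels_eq by blast
  \<comment> \<open>If \<open>p\<close> is empty, the tuple sits on the relation itself; otherwise
    it sits on the first letter of \<open>p\<close>, and the relation is used with the unit
    tuple.\<close>
  have "(decorate a (p @ u @ q), decorate a (p @ v @ q)) \<in> \<rho>"
    if a: "a \<in> tuples M n" and pq: "p \<in> lists (letters {1..n})" "q \<in> lists (letters {1..n})" for a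
  proof (cases "p = []")
    case True
    then show ?thesis
      using congruence_context[OF congruence rel[OF a], of "[]" "unit_word q"] uv unit_word_in[OF pq(2)]
      by (simp add: decorate_append)
  next
    case False
    then show ?thesis
      using congruence_context[OF congruence rel[OF one_tuple_in], of "decorate a p" "unit_word q"]
        unit_word_in[OF pq(2)] decorate_in[OF a pq(1)]
      by (simp add: decorate_append decorate_one)
  qed
  then show ?case using uv by auto
qed

text \<open>Working from the right, the tuples of the tail are collected in its first letter; R7 on
  the first two letters then transfers them to the head, where \<open>join\<close> gives the tuple
  of the product.\<close>

lemma congruent_decorate:
  "w \<noteq> [] \<Longrightarrow> set w \<subseteq> alphabet M n \<Longrightarrow> (w, decorate (fst (phi M n w)) (map index w)) \<in> \<rho>"
proof (induction w rule: list_nonempty_induct)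
  case (single x)
  obtain i j a where x: "x = E i j a" by (cases x)
  show ?case
    using congruence_refl[of "[x]"] single by (simp add: phi_single x)
next
  case (cons x w)
  define c where "c = fst (phi M n w)"
  have c: "c \<in> tuples M n"
    using phi_in[of w] cons.hyps cons.prems by (simp add: c_def mem_Times_iff)
  obtain i j a where x: "x = E i j a" "i \<in> {1..n}" "j \<in> {1..n}" "i \<noteq> j" "a \<in> tuples M n"
    using cons.prems by (auto simp: alphabet_def)
  obtain k l b w' where w: "w = E k l b # w'" and kl: "k \<in> {1..n}" "l \<in> {1..n}" "k \<noteq> l"
    using cons by (cases w) (auto simp: alphabet_def)
  have "map index w' \<in> lists (letters {1..n})"
    by (rule index_in) (use cons.prems w in auto)
  note w'_in = unit_word_in[OF this]
  have "(w, decorate c (map index w)) \<in> \<rho>"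
    using cons by (simp add: c_def)
  from congruence_context[OF congruence this, of "[x]" "[]"]
  have "(x # w, x # decorate c (map index w)) \<in> \<rho>"
    using cons.prems by simp
  also have "x # decorate c (map index w) = [E i j a, E k l c] @ unit_word (map index w')"
    by (simp add: x w)
  finally have "(x # w, [E i j a, E k l c] @ unit_word (map index w')) \<in> \<rho>" .
  moreover have "([E i j a, E k l c], [E i j (join a i j c), E1 M n k l]) \<in> \<rho>"
    using rels_subset x c kl unfolding rels_eq by fast
  from congruence_context[OF congruence this, of "[]"] w'_in
  have "([E i j a, E k l c] @ unit_word (map index w'),
      [E i j (join a i j c), E1 M n k l] @ unit_word (map index w')) \<in> \<rho>" by simp
  moreover have "[E i j (join a i j c), E1 M n k l] @ unit_word (map index w') =
      decorate (fst (phi M n (x # w))) (map index (x # w))"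
    using x cons.hyps by (simp add: fst_phi_Cons c_def) (simp add: w)
  ultimately show ?case using congruence_trans by metis
qed

text \<open>Each word is congruent to its index word decorated by its tuple. Equal values give equal
  tuples and, by \<open>weq_complete\<close>, congruent index words.\<close>

lemma kernel_subset:
  assumes u: "u \<noteq> []" "set u \<subseteq> alphabet M n" and v: "v \<noteq> []" "set v \<subseteq> alphabet M n"
    and eq: "phi M n u = phi M n v"
  shows "(u, v) \<in> \<rho>"
proof -
  have "restrict (act (map index u)) {1..n} = restrict (act (map index v)) {1..n}"
    using snd_phi[OF u] snd_phi[OF v] eq by simp
  then have "act (map index u) x = act (map index v) x" if "x \<in> {1..n}" for x
    using that by (metis restrict_apply')
  then have "weq (map index u) (map index v)"
    by (intro weq_complete index_in u v)
  then have "(decorate (fst (phi M n u)) (map index u), decorate (fst (phi M n v)) (map index v)) \<in> \<rho>"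
    using decorate_weq[of "map index u" "map index v"] phi_in[OF u] u(1) index_in[OF u(2)] eq
    by (simp add: mem_Times_iff del: in_lists_conv_set)
  then show ?thesis
    using congruent_decorate[OF u] congruent_decorate[OF v] congruence_sym congruence_trans by blast
qed

end

text \<open>A nonempty word for the singular map exists, and its first letter can carry any
  tuple.\<close>

lemma phi_surj: "phi M n ` carrier (free_semigrp (alphabet M n)) = tuples M n \<times> sing n"
proof
  show "phi M n ` carrier (free_semigrp (alphabet M n)) \<subseteq> tuples M n \<times> sing n"
    by (rule image_subsetI, rule phi_in) (simp_all add: free_semigrp_def)
  show "tuples M n \<times> sing n \<subseteq> phi M n ` carrier (free_semigrp (alphabet M n))"
  proof
    fix x assume "x \<in> tuples M n \<times> sing n"
    then obtain a \<beta> where x: "x = (a, \<beta>)" "a \<in> tuples M n" "\<beta> \<in> {1..n} \<rightarrow>\<^sub>E {1..n}" "\<not> inj_on \<beta> {1..n}"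
      by (auto simp: sing_iff)
    then obtain w where w: "w \<in> lists (letters {1..n})" "w \<noteq> []" "\<forall>k \<in> {1..n}. act w k = \<beta> k"
      using singular_map_is_word[of \<beta>] by (auto simp: PiE_def)
    have "restrict (act w) {1..n} = \<beta>"
      using w(3) x(3) by (auto simp: PiE_iff extensional_def restrict_def)
    then have "phi M n (decorate a w) = x"
      using phi_decorate[OF w(2) x(2) w(1)] x(1) by simp
    then show "x \<in> phi M n ` carrier (free_semigrp (alphabet M n))"
      using decorate_in[OF x(2) w(1)] w(2) by (force simp: free_semigrp_def)
  qed
qed

lemma presentation: "has_semigrp_presentation (wreath_sing M n) (alphabet M n) (rels M n) (phi M n)"
proof -
  let ?F = "free_semigrp (alphabet M n)"
  let ?K = "{(u, v). u \<in> carrier ?F \<and> v \<in> carrier ?F \<and> phi M n u = phi M n v}"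
  have R: "rels M n \<subseteq> carrier ?F \<times> carrier ?F"
    by (rule subrelI) (simp add: free_semigrp_def rels_in)
  \<comment> \<open>The kernel is itself one of the congruences whose intersection is the generated
    congruence.\<close>
  have "semigrp_congruence ?F ?K"
    by (rule kernel_congruence[OF semigrp_free phi_hom])
  moreover have "rels M n \<subseteq> ?K"
    using R rels_phi by auto
  ultimately have "generated_congruence ?F (rels M n) \<subseteq> ?K"
    unfolding generated_congruence_def by blast
  \<comment> \<open>Conversely, \<open>kernel_subset\<close> applies to each member of the
    intersection.\<close>
  moreover have "?K \<subseteq> generated_congruence ?F (rels M n)"
    unfolding generated_congruence_def using kernel_subset by (auto simp: free_semigrp_def)
  ultimately show ?thesis
    unfolding has_semigrp_presentation_def
    using semigrp_wreath R phi_hom phi_surj by simp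
qed

end

theorem corollary5p1:
  fixes M :: "('a, 'c) monoid_scheme" and n :: nat
  assumes "n \<ge> 2" and "monoid M"
  shows "has_semigrp_presentation (wreath_sing M n) (alphabet M n) (rels M n) (phi M n)"
  using wreath.presentation[of M n] assms(2) by (simp add: wreath_def)

end
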